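(* Let $\overline{cr}(K_n)$ denote the rectilinear crossing number of the complete graph $K_n$. Then $$\lim_{n\to\infty} \frac{\overline{cr}(K_n)}{\binom{n}{4}} \le \frac{6467}{16848} \approx 0.3838.$$
   Context: A rectilinear drawing of $K_n$ is a placement of $n$ points (vertices) in the plane, no three collinear, with every pair of vertices joined by the straight line segment between them (an edge); it is assumed that no three edges meet at a point unless that point is an endpoint of all three. An edge crossing is a pair of edges whose segments intersect at a point that is not an endpoint of both. The rectilinear crossing number $\overline{cr}(K_n)$ is the minimum number of edge crossings over all rectilinear drawings of $K_n$. *)

theory Defs
  imports "HOL-Analysis.Analysis"
begin

text \<open>A rectilinear drawing of the complete graph is determined by its set of vertices. An edge is
  the two-element set of its endpoints, so that the segment it is drawn as is its convex hull.\<close>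

definition edges :: "(real^2) set \<Rightarrow> (real^2) set set" where
  "edges P = {{u, v} | u v. u \<in> P \<and> v \<in> P \<and> u \<noteq> v}"

definition rectilinear_drawing :: "nat \<Rightarrow> (real^2) set \<Rightarrow> bool" where
  "rectilinear_drawing n P \<longleftrightarrow>
     finite P \<and> card P = n \<and>
     (\<forall>a\<in>P. \<forall>b\<in>P. \<forall>c\<in>P. a \<noteq> b \<and> a \<noteq> c \<and> b \<noteq> c \<longrightarrow> \<not> collinear {a, b, c}) \<and>
     (\<forall>e\<in>edges P. \<forall>f\<in>edges P. \<forall>g\<in>edges P. e \<noteq> f \<and> e \<noteq> g \<and> f \<noteq> g \<longrightarrow>
        (\<forall>x \<in> convex hull e \<inter> convex hull f \<inter> convex hull g. x \<in> e \<inter> f \<inter> g))"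

definition edge_crossings :: "(real^2) set \<Rightarrow> (real^2) set set set" where
  "edge_crossings P =
     {{e, f} | e f. e \<in> edges P \<and> f \<in> edges P \<and> e \<noteq> f \<and>
        (\<exists>x \<in> convex hull e \<inter> convex hull f. x \<notin> e \<inter> f)}"

definition rectilinear_crossing_number :: "nat \<Rightarrow> nat" where
  "rectilinear_crossing_number n =
     (LEAST k. \<exists>P. rectilinear_drawing n P \<and> card (edge_crossings P) = k)"

end

(* For a finite planar set in general position, the sum over ordered pairs (a, b) of the number of
   points to the left of ab times the number to the right equals 6 (n choose 4) - 2 cr. This turns
   the crossing number into a quantity that only depends on orientations of triples and is easily
   computed under substitution. Take 15 points with 447 crossings such that through every point
   there is a line bisecting the other 14, and replace each point by a tiny optimal drawing of K_k
   flattened along that line. Writing cr(K_n) ~ L n^4 / 24, the resulting drawing of K_{15k} yields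
   L (15^4 - 15) / 24 <= 447 + 15 * 21 + 15 * 14 / 8 + 15 * 14 / 12, that is L <= 3223 / 8435 = 0.3821....
   A limit exists because deleting vertices from an optimal drawing shows that
   cr(K_n) / (n choose 4) is nondecreasing. A perturbation avoiding finitely many lines makes any
   set in general position a drawing without triple crossings and without changing orientations. *)

theory Submission
  imports Defs "HOL-Real_Asymp.Real_Asymp"
begin

subsection \<open>Orientations and crossings\<close>

text \<open>The summands after 447 sort the crossings by how their endpoints fall into copies, in
  units of k^4. Two endpoints in one copy and two in further copies: a crossing exactly when the
  latter lie on one side of the first copy's line, and a 7-7 split minimises such pairs at 2 * (7
  choose 2) = 42, whence 15 * 42 / 2 = 15 * 21. Two and two: always a crossing, (15 choose 2) / 4 =
  15 * 14 / 8. Three and one: bisection makes exactly half of these cross, whatever drawing is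
  inserted, giving 15 * 14 / 12. Four in one copy: 15 L / 24, which moves to the left and turns 15^4
  into 15^4 - 15. Exact bisection forces an odd number of base points. Flattening puts every other
  copy wholly on one side of each line spanned by a copy. The formal count avoids these cases:
  separations are a sum over pairs, so only pairs within one copy and pairs across two copies have
  to be told apart.\<close>

definition orient :: "real^2 \<Rightarrow> real^2 \<Rightarrow> real^2 \<Rightarrow> real" where
  "orient a b c = (b$1 - a$1) * (c$2 - a$2) - (b$2 - a$2) * (c$1 - a$1)"

lemma orient_same [simp]: "orient a a b = 0" "orient a b a = 0" "orient a b b = 0"
  by (auto simp: orient_def algebra_simps)

lemma orient_cycle: "orient b c a = orient a b c"
  by (simp add: orient_def algebra_simps)

lemma orient_swap: "orient b a c = - orient a b c"
  by (simp add: orient_def algebra_simps)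

text \<open>\<open>orient\<close> is twice the signed area of a triangle, and the two diagonals cut
  a quadrilateral into triangles with the same total. This relation excludes impossible sign
  patterns of four points.\<close>

lemma orient_relation: "orient a b c - orient a b d + orient a c d - orient b c d = 0"
  by (simp add: orient_def algebra_simps)

lemma orient_affine: "orient a b ((1 - t) *\<^sub>R c + t *\<^sub>R d) = (1 - t) * orient a b c + t * orient a b d"
  by (simp add: orient_def algebra_simps)

lemma collinear_iff_orient: "collinear {a, b, c} \<longleftrightarrow> orient a b c = 0"
proof -
  have "collinear {a, b, c} \<longleftrightarrow> collinear {0, a - b, c - b}"
    using collinear_3[of a b c] by (simp add: NO_MATCH_def)
  also have "\<dots> \<longleftrightarrow> orient a b c = 0"
  proof (cases "c = b")
    case False
    then have ne: "c$1 - b$1 \<noteq> 0 \<or> c$2 - b$2 \<noteq> 0"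
      by (auto simp: vec_eq_iff forall_2)
    have "collinear {0, a - b, c - b} \<longleftrightarrow> collinear {0, c - b, a - b}"
      by (simp add: insert_commute)
    also have "\<dots> \<longleftrightarrow> (\<exists>k. a - b = k *\<^sub>R (c - b)) \<or> a - b = 0"
      using False by (auto simp: collinear_lemma)
    also have "\<dots> \<longleftrightarrow> (\<exists>k. a - b = k *\<^sub>R (c - b))"
      by (metis scaleR_zero_left)
    also have "\<dots> \<longleftrightarrow> (\<exists>k. a$1 - b$1 = k * (c$1 - b$1) \<and> a$2 - b$2 = k * (c$2 - b$2))"
      by (simp add: vec_eq_iff forall_2)
    also have "\<dots> \<longleftrightarrow> (a$1 - b$1) * (c$2 - b$2) = (a$2 - b$2) * (c$1 - b$1)"
      (is "?L \<longleftrightarrow> ?R")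
    proof
      assume ?L then show ?R by (elim exE conjE) simp
    next
      assume R: ?R
      from ne show ?L
      proof
        assume "c$1 - b$1 \<noteq> 0"
        then show ?L using R
          by (intro exI[of _ "(a$1 - b$1) / (c$1 - b$1)"]) (simp add: field_simps)
      next
        assume "c$2 - b$2 \<noteq> 0"
        then show ?L using R
          by (intro exI[of _ "(a$2 - b$2) / (c$2 - b$2)"]) (simp add: field_simps)
      qed
    qed
    also have "\<dots> \<longleftrightarrow> orient a b c = 0"
      by (auto simp: orient_def algebra_simps)
    finally show ?thesis .
  qed (simp add: insert_commute)
  finally show ?thesis .
qed

definition in_general_position :: "'a set \<Rightarrow> ('a \<Rightarrow> real^2) \<Rightarrow> bool" where
  "in_general_position I f \<longleftrightarrow> inj_on f I \<and> 
     (\<forall>a\<in>I. \<forall>b\<in>I. \<forall>c\<in>I. a \<noteq> b \<and> a \<noteq> c \<and> b \<noteq> c \<longrightarrow> orient (f a) (f b) (f c) \<noteq> 0)"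

lemma rectilinear_drawing_iff:
  "rectilinear_drawing n P \<longleftrightarrow> finite P \<and> card P = n \<and> in_general_position P id \<and>
     (\<forall>e\<in>edges P. \<forall>f\<in>edges P. \<forall>g\<in>edges P. e \<noteq> f \<and> e \<noteq> g \<and> f \<noteq> g \<longrightarrow>
        (\<forall>x \<in> convex hull e \<inter> convex hull f \<inter> convex hull g. x \<in> e \<inter> f \<inter> g))"
  by (simp add: rectilinear_drawing_def in_general_position_def collinear_iff_orient)

text \<open>The inequalities are strict, so quadruples with a repeated point drop out on their
  own.\<close>

definition crosses :: "real^2 \<Rightarrow> real^2 \<Rightarrow> real^2 \<Rightarrow> real^2 \<Rightarrow> bool" where
  "crosses a b c d \<longleftrightarrow>
     orient a b c * orient a b d < 0 \<and> orient c d a * orient c d b < 0"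

lemma orient_segment_zero: "x \<in> closed_segment a b \<Longrightarrow> orient a b x = 0"
  by (auto simp: closed_segment_def orient_affine)

text \<open>Orientation with respect to a fixed line is affine along a segment, so a meeting point
  is a zero between values of opposite sign; conversely the zeros give the parameters of the meeting
  point.\<close>

lemma crosses_iff_segments_meet:
  assumes "orient a b c \<noteq> 0" "orient a b d \<noteq> 0" "orient c d a \<noteq> 0" "orient c d b \<noteq> 0"
  shows "crosses a b c d \<longleftrightarrow> closed_segment a b \<inter> closed_segment c d \<noteq> {}"
proof
  have *: "p * q < 0" if "(1 - s) * p + s * q = 0" "0 \<le> s" "s \<le> 1" "p \<noteq> 0" "q \<noteq> 0" for p q s :: real
  proof -
    have s: "s > 0" "s < 1" using that by (auto simp: less_le)
    have "s * (p * q) = - ((1 - s) * (p * p))"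
      using that(1) by algebra
    also have "\<dots> < 0" using s that by (simp add: zero_less_mult_iff mult_less_0_iff) (metis linorder_neqE_linordered_idom)
    finally show ?thesis using s by (simp add: mult_less_0_iff)
  qed
  assume "closed_segment a b \<inter> closed_segment c d \<noteq> {}"
  then obtain x s t where x: "x = (1 - t) *\<^sub>R a + t *\<^sub>R b" "x = (1 - s) *\<^sub>R c + s *\<^sub>R d"
    and st: "0 \<le> t" "t \<le> 1" "0 \<le> s" "s \<le> 1"
    unfolding closed_segment_def by blast
  have "orient a b x = 0" by (simp add: x(1) orient_affine)
  then have 1: "(1 - s) * orient a b c + s * orient a b d = 0" by (simp add: x(2) orient_affine)
  have "orient c d x = 0" by (simp add: x(2) orient_affine)
  then have "(1 - t) * orient c d a + t * orient c d b = 0" by (simp add: x(1) orient_affine)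
  with 1 assms st * show "crosses a b c d"
    unfolding crosses_def by blast
next
  assume cr: "crosses a b c d"
  define p q u v where pq: "p = orient a b c" "q = orient a b d" 
    "u = orient c d a" "v = orient c d b"
  define s t where st: "s = p / (p - q)" "t = u / (u - v)"
  have pq0: "p * q < 0" "u * v < 0" using cr by (auto simp: crosses_def pq)
  then have ne: "p - q \<noteq> 0" "u - v \<noteq> 0"
    by (metis diff_eq_diff_eq diff_self mult_less_0_iff not_less_iff_gr_or_eq)+
  have st01: "0 \<le> s" "s \<le> 1" "0 \<le> t" "t \<le> 1"
    using pq0 by (auto simp: st divide_simps mult_less_0_iff)
  \<comment> \<open>This is \<open>orient_relation\<close>; it makes the two denominators equal up
    to sign, so coordinates can be compared after multiplying by \<open>p - q\<close>.\<close>
  have uv: "u - v = q - p" by (simp add: pq orient_def algebra_simps)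
  have 1: "(p - q) * ((b - a)$i) * t = - u * (b-a)$i" for i
    using ne uv by (simp add: st divide_simps) (simp add: algebra_simps)
  have 2: "(p - q) * ((d - c)$i) * s = p * (d-c)$i" for i
    using ne by (simp add: st divide_simps)
  have 3: "- u * (b-a)$i - p * (d-c)$i = (p - q) * (c - a)$i" for i
    using exhaust_2[of i] by (auto simp: pq orient_def algebra_simps)
  have "(p - q) * (((1 - t) *\<^sub>R a + t *\<^sub>R b)$i) = (p - q) * (((1 - s) *\<^sub>R c + s *\<^sub>R d)$i)" for i
    using 1[of i] 2[of i] 3[of i] by (simp add: algebra_simps)
  then have "(1 - t) *\<^sub>R a + t *\<^sub>R b = (1 - s) *\<^sub>R c + s *\<^sub>R d"
    using ne by (simp add: vec_eq_iff)
  with st01 show "closed_segment a b \<inter> closed_segment c d \<noteq> {}"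
    by (auto simp: closed_segment_def disjoint_iff)
qed

lemma segments_common_endpoint:
  assumes "orient u v w \<noteq> 0" "x \<in> closed_segment u v" "x \<in> closed_segment u w"
  shows "x = u"
proof -
  obtain s where s: "x = (1 - s) *\<^sub>R u + s *\<^sub>R w" using assms(3) by (auto simp: closed_segment_def)
  have "orient u v x = 0" using assms(2) by (rule orient_segment_zero)
  then have "s = 0" using assms(1) by (simp add: s orient_affine)
  then show ?thesis by (simp add: s)
qed

lemma crosses_distinct: "crosses a b c d \<Longrightarrow> distinct [a, b, c, d]"
  by (auto simp: crosses_def)

text \<open>In general position two edges with a common vertex meet only there, and the definition
  does not count that point; so a crossing has four distinct endpoints.\<close>

lemma edge_crossings_eq_image:
  assumes gp: "in_general_position P id"
  shows "edge_crossings P = (\<lambda>(a, b, c, d). {{a, b}, {c, d}}) `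
     {(a, b, c, d). a \<in> P \<and> b \<in> P \<and> c \<in> P \<and> d \<in> P \<and> crosses a b c d}" (is "_ = ?R")
proof (intro equalityI subsetI)
  have o: "orient a b c \<noteq> 0" if "a \<in> P" "b \<in> P" "c \<in> P" "a \<noteq> b" "a \<noteq> c" "b \<noteq> c" for a b c
    using gp that by (auto simp: in_general_position_def)
  {
    fix X assume "X \<in> edge_crossings P"
    then obtain e f x where ef: "e \<in> edges P" "f \<in> edges P" "e \<noteq> f" "X = {e, f}"
      and "x \<in> convex hull e" "x \<in> convex hull f" "x \<notin> e \<inter> f"
      unfolding edge_crossings_def by blast
    moreover obtain a b where "e = {a, b}" "a \<in> P" "b \<in> P" "a \<noteq> b" 
      using ef(1) unfolding edges_def by blast
    moreover obtain c d where "f = {c, d}" "c \<in> P" "d \<in> P" "c \<noteq> d" 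
      using ef(2) unfolding edges_def by blast
    ultimately obtain a b c d x where X: "X = {{a, b}, {c, d}}" "a \<in> P" "b \<in> P" "c \<in> P" "d \<in> P"
      "a \<noteq> b" "c \<noteq> d" "{a, b} \<noteq> {c, d}" 
      and x: "x \<in> closed_segment a b" "x \<in> closed_segment c d" "x \<notin> {a, b} \<inter> {c, d}"
      unfolding segment_convex_hull by blast
    have "distinct [a, b, c, d]"
    proof (rule ccontr)
      assume "\<not> ?thesis"
      then consider "a = c" | "a = d" | "b = c" | "b = d" using X by auto
      then show False
      proof cases
        case 1 with x X o[of a b d] segments_common_endpoint[of a b d x] show False by auto
      next
        case 2 with x X o[of a b c] segments_common_endpoint[of a b c x] show False 
          by (auto simp: closed_segment_commute)
      next
        case 3 with x X o[of b a d] segments_common_endpoint[of b a d x] show False 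
          by (auto simp: closed_segment_commute)
      next
        case 4 with x X o[of b a c] segments_common_endpoint[of b a c x] show False 
          by (auto simp: closed_segment_commute)
      qed
    qed
    then have "crosses a b c d"
      using x(1,2) X(2-5) o[of a b c] o[of a b d] o[of c d a] o[of c d b]
      by (subst crosses_iff_segments_meet) auto
    then show "X \<in> ?R" using X by (auto intro!: image_eqI[of _ _ "(a, b, c, d)"])
  }
  {
    fix X assume "X \<in> ?R"
    then obtain a b c d where X: "X = {{a, b}, {c, d}}" "a \<in> P" "b \<in> P" "c \<in> P" "d \<in> P"
      and cr: "crosses a b c d" by auto
    have ne: "distinct [a, b, c, d]" using cr by (rule crosses_distinct)
    have "closed_segment a b \<inter> closed_segment c d \<noteq> {}"
      using cr ne X(2-5) o[of a b c] o[of a b d] o[of c d a] o[of c d b]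
      by (subst crosses_iff_segments_meet[symmetric]) auto
    then obtain x where x: "x \<in> convex hull {a, b} \<inter> convex hull {c, d}" by (auto simp: segment_convex_hull)
    have "{a, b} \<in> edges P" "{c, d} \<in> edges P" "{a, b} \<noteq> {c, d}" "x \<notin> {a, b} \<inter> {c, d}"
      using X ne by (auto simp: edges_def doubleton_eq_iff)
    with x X(1) show "X \<in> edge_crossings P"
      unfolding edge_crossings_def by blast
  }
qed

lemma crosses_sym:
  "crosses b a c d \<longleftrightarrow> crosses a b c d" "crosses a b d c \<longleftrightarrow> crosses a b c d"
  "crosses c d a b \<longleftrightarrow> crosses a b c d"
  unfolding crosses_def
  by (auto simp: orient_swap[of b a] orient_swap[of d c] mult.commute)

text \<open>The factor 8 is 2 * 2 * 2: the order of the endpoints on each edge and the order of the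
  two edges.\<close>

lemma card_crossing_tuples:
  assumes gp: "in_general_position P id" and fin: "finite P"
  shows "card {(a, b, c, d). a \<in> P \<and> b \<in> P \<and> c \<in> P \<and> d \<in> P \<and> crosses a b c d} 
     = 8 * card (edge_crossings P)" (is "card ?A = _")
proof -
  define h where "h = (\<lambda>(a, b, c, d). {{a, b}, {c, d :: real^2}})"
  have "?A \<subseteq> P \<times> P \<times> P \<times> P" by auto
  then have finA: "finite ?A" using fin by (meson finite_SigmaI finite_subset)
  have fib: "card {t \<in> ?A. h t = y} = 8" if y: "y \<in> h ` ?A" for y
  proof -
    obtain a b c d where X: "y = {{a, b}, {c, d}}" "a \<in> P" "b \<in> P" "c \<in> P" "d \<in> P"
      and cr: "crosses a b c d" using y by (auto simp: h_def)
    have ne: "distinct [a, b, c, d]" using cr by (rule crosses_distinct)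
    have "{t \<in> ?A. h t = y} = {(a,b,c,d), (b,a,c,d), (a,b,d,c), (b,a,d,c),
       (c,d,a,b), (d,c,a,b), (c,d,b,a), (d,c,b,a)}" (is "?L = ?R")
    proof
      have "crosses b a c d" "crosses a b d c" "crosses b a d c"
        "crosses c d a b" "crosses d c a b" "crosses c d b a" "crosses d c b a"
        using cr by (simp_all only: crosses_sym(1,2) crosses_sym(3)[of c d a b])
      then show "?R \<subseteq> ?L" using X cr by (simp add: h_def insert_commute)
      show "?L \<subseteq> ?R"
      proof (intro subsetI)
        fix t assume "t \<in> ?L"
        then obtain p q r s where t: "t = (p, q, r, s)" "{{p, q}, {r, s}} = {{a, b}, {c, d}}"
          using X(1) by (cases t) (simp add: h_def)
        have "{p, q} = {a, b} \<and> {r, s} = {c, d} \<or> {p, q} = {c, d} \<and> {r, s} = {a, b}"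
          by (rule iffD1[OF doubleton_eq_iff t(2)])
        then show "t \<in> ?R"
          unfolding t(1) by (elim disjE conjE) (simp_all add: doubleton_eq_iff, auto)
      qed
    qed
    then show ?thesis using ne by simp
  qed
  have "card ?A = (\<Sum>y \<in> h ` ?A. card {t \<in> ?A. h t = y})"
    using sum.image_gen[OF finA, of "\<lambda>_. 1::nat" h] by simp
  also have "\<dots> = 8 * card (h ` ?A)" using fib by simp
  finally show ?thesis using edge_crossings_eq_image[OF gp] by (simp add: h_def)
qed

subsection \<open>Counting separations\<close>

text \<open>\<open>\<omega>\<close> is an arbitrary function since only its signs matter; counts can
  then pass between point sets and index sets.\<close>

definition lefts :: "'a set \<Rightarrow> ('a \<Rightarrow> 'a \<Rightarrow> 'a \<Rightarrow> real) \<Rightarrow> 'a \<Rightarrow> 'a \<Rightarrow> nat" where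
  "lefts I \<omega> a b = card {c \<in> I. 0 < \<omega> a b c}"

definition rights :: "'a set \<Rightarrow> ('a \<Rightarrow> 'a \<Rightarrow> 'a \<Rightarrow> real) \<Rightarrow> 'a \<Rightarrow> 'a \<Rightarrow> nat" where
  "rights I \<omega> a b = card {c \<in> I. \<omega> a b c < 0}"

definition separations :: "'a set \<Rightarrow> ('a \<Rightarrow> 'a \<Rightarrow> 'a \<Rightarrow> real) \<Rightarrow> nat" where
  "separations I \<omega> = (\<Sum>a\<in>I. \<Sum>b\<in>I. lefts I \<omega> a b * rights I \<omega> a b)"

definition orient_of :: "('a \<Rightarrow> real^2) \<Rightarrow> 'a \<Rightarrow> 'a \<Rightarrow> 'a \<Rightarrow> real" where
  "orient_of f a b c = orient (f a) (f b) (f c)"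

lemma separations_cong:
  assumes "\<And>a b c. a \<in> I \<Longrightarrow> b \<in> I \<Longrightarrow> c \<in> I \<Longrightarrow> sgn (\<omega> a b c) = sgn (\<omega>' a b c)"
  shows "separations I \<omega> = separations I \<omega>'"
proof -
  have "(0 < \<omega> a b c \<longleftrightarrow> 0 < \<omega>' a b c) \<and> (\<omega> a b c < 0 \<longleftrightarrow> \<omega>' a b c < 0)" 
    if "a \<in> I" "b \<in> I" "c \<in> I" for a b c
    using assms[OF that] by (metis sgn_1_neg sgn_1_pos)
  then show ?thesis
    unfolding separations_def lefts_def rights_def 
    by (intro sum.cong refl arg_cong2[where f = "(*)"] arg_cong[where f = card]) auto
qed

lemma separations_image:
  assumes "inj_on f I"
  shows "separations (f ` I) orient = separations I (orient_of f)"
proof -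
  have "card {c \<in> f ` I. Q c} = card {c \<in> I. Q (f c)}" for Q
  proof -
    have "{c \<in> f ` I. Q c} = f ` {c \<in> I. Q (f c)}" by auto
    moreover have "inj_on f {c \<in> I. Q (f c)}" using assms by (rule inj_on_subset) auto
    ultimately show ?thesis by (simp add: card_image)
  qed
  then show ?thesis
    by (simp add: separations_def lefts_def rights_def orient_of_def sum.reindex[OF assms])
qed

section \<open>Sums over ordered quadruples\<close>

definition sum4 :: "'a set \<Rightarrow> ('a \<Rightarrow> 'a \<Rightarrow> 'a \<Rightarrow> 'a \<Rightarrow> int) \<Rightarrow> int" where
  "sum4 I F = (\<Sum>a\<in>I. \<Sum>b\<in>I. \<Sum>c\<in>I. \<Sum>d\<in>I. F a b c d)"

lemma sum4_swap12: "sum4 I (\<lambda>a b c d. F b a c d) = sum4 I F"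
  unfolding sum4_def by (rule sum.swap)

lemma sum4_swap23: "sum4 I (\<lambda>a b c d. F a c b d) = sum4 I F"
  unfolding sum4_def by (intro sum.cong refl sum.swap)

lemma sum4_swap34: "sum4 I (\<lambda>a b c d. F a b d c) = sum4 I F"
  unfolding sum4_def by (intro sum.cong refl sum.swap)

text \<open>These permutations carry the six pairs and the three pairings of a quadruple to a
  standard position, so all of them contribute equally to the total.\<close>

lemma sum4_perms:
  "sum4 I (\<lambda>a b c d. F a c b d) = sum4 I F"
  "sum4 I (\<lambda>a b c d. F b c a d) = sum4 I F"
  "sum4 I (\<lambda>a b c d. F a d b c) = sum4 I F"
  "sum4 I (\<lambda>a b c d. F b d a c) = sum4 I F"
  "sum4 I (\<lambda>a b c d. F c d a b) = sum4 I F"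
proof -
  show 1: "sum4 I (\<lambda>a b c d. F a c b d) = sum4 I F" by (rule sum4_swap23)
  show 2: "sum4 I (\<lambda>a b c d. F b c a d) = sum4 I F"
    using sum4_swap12[of I "\<lambda>a b c d. F a c b d"] 1 by simp
  show "sum4 I (\<lambda>a b c d. F a d b c) = sum4 I F"
    using sum4_swap34[of I "\<lambda>a b c d. F a c b d"] 1 by simp
  show 4: "sum4 I (\<lambda>a b c d. F b d a c) = sum4 I F"
    using sum4_swap34[of I "\<lambda>a b c d. F b c a d"] 2 by simp
  show "sum4 I (\<lambda>a b c d. F c d a b) = sum4 I F"
    using sum4_swap23[of I "\<lambda>a b c d. F b d a c"] 4 by simp
qed

lemma sum4_add: "sum4 I (\<lambda>a b c d. F a b c d + G a b c d) = sum4 I F + sum4 I G"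
  by (simp add: sum4_def sum.distrib)

lemma card_tuples:
  assumes "finite I"
  shows "int (card {(a, b, c, d). a \<in> I \<and> b \<in> I \<and> c \<in> I \<and> d \<in> I \<and> Q a b c d}) 
    = sum4 I (\<lambda>a b c d. of_bool (Q a b c d))"
proof -
  have "sum4 I (\<lambda>a b c d. of_bool (Q a b c d)) = (\<Sum>(a, b, c, d)\<in>I \<times> I \<times> I \<times> I. of_bool (Q a b c d))"
    by (simp add: sum4_def sum.cartesian_product)
  also have "\<dots> = (\<Sum>t\<in>I \<times> I \<times> I \<times> I. of_bool (case t of (a, b, c, d) \<Rightarrow> Q a b c d))"
    by (intro sum.cong) auto
  also have "\<dots> = int (card ((I \<times> I \<times> I \<times> I) \<inter> {t. case t of (a, b, c, d) \<Rightarrow> Q a b c d}))"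
    using assms by (simp add: sum_of_bool_eq)
  also have "(I \<times> I \<times> I \<times> I) \<inter> {t. case t of (a, b, c, d) \<Rightarrow> Q a b c d} 
    = {(a, b, c, d). a \<in> I \<and> b \<in> I \<and> c \<in> I \<and> d \<in> I \<and> Q a b c d}"
    by auto
  finally show ?thesis by simp
qed

lemma separations_eq_sum4:
  assumes "finite I"
  shows "int (separations I \<omega>) = sum4 I (\<lambda>a b c d. of_bool (0 < \<omega> a b c \<and> \<omega> a b d < 0))"
proof -
  have c: "int (card {c \<in> I. Q c}) = (\<Sum>c\<in>I. of_bool (Q c))" for Q
    using assms by (simp add: sum_of_bool_eq Int_def)
  show ?thesis
    by (simp add: separations_def lefts_def rights_def sum4_def c sum_product of_bool_conj)
qed

lemma sum_distinct_snoc: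
  assumes "finite I" "set xs \<subseteq> I"
  shows "(\<Sum>d\<in>I. of_bool (distinct (xs @ [d]))) = of_bool (distinct xs) * (int (card I) - int (length xs))"
proof (cases "distinct xs")
  case True
  then have "(\<Sum>d\<in>I. of_bool (distinct (xs @ [d]))) = (\<Sum>d\<in>I. of_bool (d \<notin> set xs) :: int)"
    by (intro sum.cong) auto
  also have "\<dots> = int (card (I - set xs))"
    using assms by (simp add: sum_of_bool_eq) (metis Collect_neg_eq Diff_eq Collect_mem_eq)
  also have "\<dots> = int (card I) - int (length xs)"
    using assms True card_mono[OF assms] by (simp add: card_Diff_subset distinct_card of_nat_diff)
  finally show ?thesis using True by simp
qed simp

lemma sum4_distinct:
  assumes "finite I"
  shows "sum4 I (\<lambda>a b c d. of_bool (distinct [a, b, c, d])) =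
    int (card I) * (int (card I) - 1) * (int (card I) - 2) * (int (card I) - 3)"
proof -
  have "sum4 I (\<lambda>a b c d. of_bool (distinct [a, b, c, d])) =
    (\<Sum>a\<in>I. \<Sum>b\<in>I. \<Sum>c\<in>I. of_bool (distinct [a, b, c]) * (int (card I) - 3))"
    using sum_distinct_snoc[OF assms, of "[_, _, _]"] unfolding sum4_def
    by (intro sum.cong refl) simp
  also have "\<dots> = (\<Sum>a\<in>I. \<Sum>b\<in>I. of_bool (distinct [a, b]) * (int (card I) - 2) * (int (card I) - 3))"
    using sum_distinct_snoc[OF assms, of "[_, _]"]
    by (intro sum.cong refl) (simp add: sum_distrib_right[symmetric])
  also have "\<dots> = (\<Sum>a\<in>I. (int (card I) - 1) * (int (card I) - 2) * (int (card I) - 3))"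
    using sum_distinct_snoc[OF assms, of "[_]"]
    by (intro sum.cong refl) (simp add: sum_distrib_right[symmetric])
  finally show ?thesis by simp
qed

lemma real_choose_4: "real (n choose 4) = real n * (real n - 1) * (real n - 2) * (real n - 3) / 24"
  by (simp add: binomial_gbinomial gbinomial_prod_rev eval_nat_numeral field_simps)

text \<open>Among four points in general position, the six pairs contain three whose line separates the
  other two points if one of the points lies inside the triangle of the others, and two such pairs
  (the diagonals) if the points are in convex position.\<close>

lemma separating_pairs_of_quadruple:
  assumes gp: "in_general_position P id" and P: "a \<in> P" "b \<in> P" "c \<in> P" "d \<in> P"
  defines "s \<equiv> \<lambda>a b c d. of_bool (orient a b c * orient a b d < 0) :: int"
  defines "x \<equiv> \<lambda>a b c d. of_bool (crosses a b c d) :: int"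
  shows "s a b c d + s c d a b + s a c b d + s b d a c + s a d b c + s b c a d 
    + x a b c d + x a c b d + x a d b c = 3 * of_bool (distinct [a, b, c, d])"
proof (cases "distinct [a, b, c, d]")
  case False
  \<comment> \<open>A repeated point makes a factor zero, or makes the product a square when the
    last two points agree.\<close>
  have 1: "s p q r t = 0" if "\<not> distinct [p, q, r, t]" for p q r t
  proof -
    from that consider "p = q" | "p = r" | "p = t" | "q = r" | "q = t" | "r = t" by auto
    then show ?thesis by cases (simp_all add: s_def not_less)
  qed
  have 2: "x p q r t = 0" if "\<not> distinct [p, q, r, t]" for p q r t
    using that crosses_distinct[of p q r t] by (auto simp: x_def)
  have "s a b c d = 0" "s c d a b = 0" "s a c b d = 0" "s b d a c = 0" "s a d b c = 0" "s b c a d = 0"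
    by (rule 1, use False in auto)+
  moreover have "x a b c d = 0" "x a c b d = 0" "x a d b c = 0"
    by (rule 2, use False in auto)+
  moreover have "of_bool (distinct [a, b, c, d]) = (0 :: int)" using False by simp
  ultimately show ?thesis by (simp only: add_0 mult_zero_right)
next
  case True
  define A B C D where ABCD: "A = orient a b c" "B = orient a b d" "C = orient a c d" "D = orient b c d"
  have ne: "A \<noteq> 0" "B \<noteq> 0" "C \<noteq> 0" "D \<noteq> 0"
    using gp P True by (auto simp: ABCD in_general_position_def)
  have rel: "A - B + C - D = 0" unfolding ABCD by (rule orient_relation)
  have o: "orient a b c = A" "orient a b d = B" "orient c d a = C" "orient c d b = D"
    "orient a c b = -A" "orient a c d = C" "orient b d a = B" "orient b d c = -D"
    "orient a d b = -B" "orient a d c = -C" "orient b c a = A" "orient b c d = D"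
    by (simp_all add: ABCD orient_def algebra_simps)
  have neg: "A * B < 0 \<longleftrightarrow> (0 < A) \<noteq> (0 < B)" "C * D < 0 \<longleftrightarrow> (0 < C) \<noteq> (0 < D)"
    "- A * C < 0 \<longleftrightarrow> (0 < A) = (0 < C)" "B * - D < 0 \<longleftrightarrow> (0 < B) = (0 < D)"
    "- B * - C < 0 \<longleftrightarrow> (0 < B) \<noteq> (0 < C)" "A * D < 0 \<longleftrightarrow> (0 < A) \<noteq> (0 < D)"
    using ne by (auto simp: mult_less_0_iff zero_less_mult_iff)
  \<comment> \<open>Alternating signs would make all four summands of \<open>rel\<close> agree in
    sign. The remaining fourteen patterns are checked directly.\<close>
  have "\<not> (0 < A \<and> \<not> 0 < B \<and> 0 < C \<and> \<not> 0 < D)" "\<not> (\<not> 0 < A \<and> 0 < B \<and> \<not> 0 < C \<and> 0 < D)"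
    using rel ne by linarith+
  then show ?thesis unfolding s_def x_def crosses_def o neg eqTrueI[OF True]
    by (cases "0 < A"; cases "0 < B"; cases "0 < C"; cases "0 < D") simp_all
qed

text \<open>Separating pairs plus crossings is 3 for every quadruple. Each separating pair is
  counted in both directions, which doubles the 3 and the coefficient of the crossings.\<close>

lemma separations_plus_crossings:
  assumes gp: "in_general_position P id" and fin: "finite P"
  shows "real (separations P orient) + 2 * real (card (edge_crossings P)) = 6 * real (card P choose 4)"
proof -
  define s where "s = (\<lambda>a b c d. of_bool (orient a b c * orient a b d < 0) :: int)"
  define x where "x = (\<lambda>a b c d. of_bool (crosses a b c d) :: int)"
  define w where "w = (\<lambda>a b c d. of_bool (0 < orient a b c \<and> orient a b d < 0) :: int)"
  have "s a b c d = w a b c d + w a b d c" for a b c d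
    by (auto simp: s_def w_def mult_less_0_iff)
  then have "sum4 P s = sum4 P (\<lambda>a b c d. w a b c d + w a b d c)" by (simp add: sum4_def)
  then have 1: "sum4 P s = 2 * int (separations P orient)"
    using separations_eq_sum4[OF fin, of orient] sum4_swap34[of P w] by (simp add: w_def sum4_add)
  have 2: "sum4 P x = 8 * int (card (edge_crossings P))"
    using card_tuples[OF fin, of crosses] card_crossing_tuples[OF gp fin] by (simp add: x_def)
  have "sum4 P (\<lambda>a b c d. s a b c d + s c d a b + s a c b d + s b d a c + s a d b c + s b c a d 
    + x a b c d + x a c b d + x a d b c) = sum4 P (\<lambda>a b c d. 3 * of_bool (distinct [a, b, c, d]))"
    unfolding sum4_def s_def x_def
    by (intro sum.cong refl separating_pairs_of_quadruple[OF gp])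
  also have "\<dots> = 3 * sum4 P (\<lambda>a b c d. of_bool (distinct [a, b, c, d]))"
    by (simp only: sum4_def sum_distrib_left)
  finally have "6 * sum4 P s + 3 * sum4 P x = 
    3 * (int (card P) * (int (card P) - 1) * (int (card P) - 2) * (int (card P) - 3))"
    by (simp only: sum4_add sum4_perms[where F = s] sum4_perms[where F = x] sum4_distinct[OF fin])
  then have "12 * int (separations P orient) + 24 * int (card (edge_crossings P)) = 
    3 * (int (card P) * (int (card P) - 1) * (int (card P) - 2) * (int (card P) - 3))"
    unfolding 1 2 by simp
  then have "real_of_int (12 * int (separations P orient) + 24 * int (card (edge_crossings P))) = 
    real_of_int (3 * (int (card P) * (int (card P) - 1) * (int (card P) - 2) * (int (card P) - 3)))"
    by (rule arg_cong)
  then show ?thesis by (simp add: real_choose_4)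
qed

subsection \<open>Perturbation and optimal drawings\<close>

lemma negligible_line:
  assumes "a \<noteq> b"
  shows "negligible {x. orient a b x = 0}"
proof -
  define n :: "real^2" where "n = vector [a$2 - b$2, b$1 - a$1]"
  have "n \<noteq> 0" using assms by (auto simp: n_def vec_eq_iff forall_2)
  then have "negligible {x. n \<bullet> x = n \<bullet> a}" by (intro negligible_hyperplane) simp
  moreover have "orient a b x = 0 \<longleftrightarrow> n \<bullet> x = n \<bullet> a" for x
    by (auto simp: orient_def n_def inner_vec_def sum_2 algebra_simps)
  ultimately show ?thesis by simp
qed

lemma negligible_vertical_line: "negligible {x :: real^2. x$1 = t}"
proof -
  have "(axis 1 1 :: real^2) \<noteq> 0" by (simp add: axis_def vec_eq_iff)
  then have "negligible {x :: real^2. axis 1 1 \<bullet> x = t}" by (intro negligible_hyperplane disjI1)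
  then show ?thesis by (simp add: inner_axis')
qed

text \<open>A ball has positive measure, so it is not covered by finitely many null sets; the
  genericity conditions below all become lines to avoid.\<close>

lemma ball_avoids_finitely_many_negligible:
  fixes x :: "real^2"
  assumes "finite N" "\<And>S. S \<in> N \<Longrightarrow> negligible S" "0 < e"
  obtains p where "dist p x < e" "p \<notin> \<Union>N"
proof -
  have "negligible (\<Union>N)" using assms by (intro negligible_Union) auto
  moreover have "\<not> negligible (ball x e)" using assms by (intro open_not_negligible) auto
  ultimately have "\<not> ball x e \<subseteq> \<Union>N" using negligible_subset by blast
  then obtain p where "p \<in> ball x e" "p \<notin> \<Union>N" by blast
  then show thesis using that[of p] by (simp add: dist_commute)
qed

lemma orient_nonzero:
  assumes "in_general_position I f" "a \<in> I" "b \<in> I" "c \<in> I" "distinct [a, b, c]"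
  shows "orient (f a) (f b) (f c) \<noteq> 0"
  using assms by (auto simp: in_general_position_def)

lemma finite_edges: "finite P \<Longrightarrow> finite (edges P)"
proof -
  assume "finite P"
  then have "finite ((\<lambda>(u, v). {u, v}) ` (P \<times> P))" by simp
  moreover have "edges P \<subseteq> (\<lambda>(u, v). {u, v}) ` (P \<times> P)" by (auto simp: edges_def)
  ultimately show ?thesis by (rule finite_subset[rotated])
qed

lemma vertex_on_edge:
  assumes gp: "in_general_position P id" and "e \<in> edges P" "a \<in> P" "a \<in> convex hull e"
  shows "a \<in> e"
proof (rule ccontr)
  assume "a \<notin> e"
  obtain c d where e: "e = {c, d}" "c \<in> P" "d \<in> P" "c \<noteq> d" using assms(2) by (auto simp: edges_def)
  have "orient c d a = 0" using assms(4) orient_segment_zero by (simp add: e segment_convex_hull)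
  then show False using orient_nonzero[OF gp, of c d a] e \<open>a \<notin> e\<close> \<open>a \<in> P\<close> by auto
qed

text \<open>Some endpoint of \<open>f\<close> lies off the line through \<open>e\<close>, so the
  orientation with respect to \<open>e\<close> vanishes at most once along \<open>f\<close>. Hence
  finitely many edges have finitely many meeting points.\<close>

lemma edges_meet_once:
  assumes gp: "in_general_position P id" and ef: "e \<in> edges P" "f \<in> edges P" "e \<noteq> f"
    and "y \<in> convex hull e \<inter> convex hull f" "y' \<in> convex hull e \<inter> convex hull f"
  shows "y = y'"
proof -
  obtain u v where e: "e = {u, v}" "u \<in> P" "v \<in> P" "u \<noteq> v" using ef by (auto simp: edges_def)
  have "\<exists>w z. f = {w, z} \<and> w \<in> P \<and> w \<notin> e"
    using ef e by (auto simp: edges_def doubleton_eq_iff)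
  then obtain w z where f: "f = {w, z}" "w \<in> P" "w \<notin> e" by blast
  have nz: "orient u v w \<noteq> 0" using orient_nonzero[OF gp, of u v w] e f by auto
  have par: "t = (1 - s) *\<^sub>R w + s *\<^sub>R z \<Longrightarrow> orient u v t = 0 \<Longrightarrow> 
    s = orient u v w / (orient u v w - orient u v z)" for s t
  proof -
    assume t: "t = (1 - s) *\<^sub>R w + s *\<^sub>R z" "orient u v t = 0"
    have *: "s * (orient u v w - orient u v z) = orient u v w"
      using t(2) unfolding t(1) orient_affine by (simp add: algebra_simps)
    with nz have "orient u v w - orient u v z \<noteq> 0" by auto
    with * show ?thesis by (simp add: field_simps)
  qed
  have "\<exists>s. t = (1 - s) *\<^sub>R w + s *\<^sub>R z \<and> orient u v t = 0" 
    if "t \<in> convex hull e \<inter> convex hull f" for t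
  proof -
    have "t \<in> closed_segment u v" "t \<in> closed_segment w z"
      using that by (auto simp: e f segment_convex_hull)
    then show ?thesis using orient_segment_zero by (auto simp: closed_segment_def)
  qed
  then show ?thesis using par assms by metis
qed

text \<open>Vertices are added one at a time, so only the edges at \<open>p\<close> can create a new
  coincidence. Distinct first coordinates serve later to order a copy from left to right.\<close>

lemma drawing_extend:
  assumes dr: "rectilinear_drawing n P" and "0 < \<epsilon>"
  obtains p where "dist p x < \<epsilon>" "p$1 \<notin> (\<lambda>q. q$1) ` P" "rectilinear_drawing (Suc n) (insert p P)"
proof -
  have fin: "finite P" and card: "card P = n" and gp: "in_general_position P id"
    and conc: "\<And>e f g x. e \<in> edges P \<Longrightarrow> f \<in> edges P \<Longrightarrow> g \<in> edges P \<Longrightarrow> e \<noteq> f \<Longrightarrow> e \<noteq> g \<Longrightarrow> f \<noteq> g \<Longrightarrow>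
      x \<in> convex hull e \<Longrightarrow> x \<in> convex hull f \<Longrightarrow> x \<in> convex hull g \<Longrightarrow> x \<in> e \<inter> f \<inter> g"
    using dr unfolding rectilinear_drawing_iff by blast+
  define Y where "Y = (\<Union>(e, f) \<in> {(e, f). e \<in> edges P \<and> f \<in> edges P \<and> e \<noteq> f}. convex hull e \<inter> convex hull f)"
  have "finite Y" unfolding Y_def
  proof (intro finite_UN_I)
    show "finite {(e, f). e \<in> edges P \<and> f \<in> edges P \<and> e \<noteq> f}"
      by (rule finite_subset[of _ "edges P \<times> edges P"]) (auto simp: finite_edges fin)
    fix t assume "t \<in> {(e, f). e \<in> edges P \<and> f \<in> edges P \<and> e \<noteq> f}"
    then obtain e f where t: "t = (e, f)" "e \<in> edges P" "f \<in> edges P" "e \<noteq> f" by auto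
    have "\<exists>y. convex hull e \<inter> convex hull f \<subseteq> {y}"
      using edges_meet_once[OF gp t(2-4)] by blast
    then show "finite (case t of (e, f) \<Rightarrow> convex hull e \<inter> convex hull f)"
      unfolding t(1) prod.case using finite_subset by blast
  qed
  \<comment> \<open>Lines through two old vertices guard general position, lines through an old
    vertex and a meeting point of old edges guard against triple points, and vertical lines keep
    first coordinates distinct.\<close>
  define N where "N = (\<lambda>(a, b). {p. orient a b p = 0}) ` {(a, b). a \<in> P \<and> b \<in> P \<union> Y \<and> a \<noteq> b} 
    \<union> (\<lambda>a. {p. p$1 = a$1}) ` P"
  have "finite {(a, b). a \<in> P \<and> b \<in> P \<union> Y \<and> a \<noteq> b}"
    by (rule finite_subset[of _ "P \<times> (P \<union> Y)"]) (auto simp: fin \<open>finite Y\<close>)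
  then have "finite N" using fin by (auto simp: N_def)
  moreover have "negligible S" if "S \<in> N" for S
    using that negligible_line negligible_vertical_line by (auto simp: N_def)
  ultimately obtain p where p: "dist p x < \<epsilon>" "p \<notin> \<Union>N"
    using ball_avoids_finitely_many_negligible \<open>0 < \<epsilon>\<close> by metis
  have p1: "p$1 \<notin> (\<lambda>q. q$1) ` P" and pY: "\<And>a b. a \<in> P \<Longrightarrow> b \<in> P \<union> Y \<Longrightarrow> a \<noteq> b \<Longrightarrow> orient a b p \<noteq> 0"
    using p(2) by (auto simp: N_def)
  then have pP: "p \<notin> P" by auto
  have gp': "in_general_position (insert p P) id"
    unfolding in_general_position_def
  proof (intro conjI ballI impI)
    fix a b c assume *: "a \<in> insert p P" "b \<in> insert p P" "c \<in> insert p P" "a \<noteq> b \<and> a \<noteq> c \<and> b \<noteq> c"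
    then consider "a \<in> P" "b \<in> P" "c \<in> P" | "a = p" "b \<in> P" "c \<in> P" | "a \<in> P" "b = p" "c \<in> P" 
      | "a \<in> P" "b \<in> P" "c = p" by auto
    then show "orient (id a) (id b) (id c) \<noteq> 0"
    proof cases
      case 1 then show ?thesis using orient_nonzero[OF gp, of a b c] * by simp
    next
      case 2 then show ?thesis using pY[of b c] * by (simp add: orient_cycle)
    next
      case 3 then show ?thesis using pY[of c a] * by (auto simp: orient_cycle[of a p c])
    next
      case 4 then show ?thesis using pY[of a b] * by simp
    qed
  qed simp
  have edges_cases: "e \<in> edges P \<or> (\<exists>a\<in>P. e = {p, a})" if "e \<in> edges (insert p P)" for e
    using that by (auto simp: edges_def)
  \<comment> \<open>Triples of edges are sorted by how many end at \<open>p\<close>: two new edges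
    meet only at \<open>p\<close> (\<open>F1\<close>), \<open>p\<close> lies on no old edge
    (\<open>F2\<close>), and a new edge passes a meeting point of two old ones only at its own old
    endpoint (\<open>F3\<close>).\<close>
  have F1: "x = p" if "a \<in> P" "b \<in> P" "{p, a} \<noteq> {p, b}" "x \<in> convex hull {p, a}" "x \<in> convex hull {p, b}" for a b x
    using segments_common_endpoint[of p a b x] orient_nonzero[OF gp', of p a b] that pP
    by (auto simp: segment_convex_hull)
  have F2: False if "g \<in> edges P" "p \<in> convex hull g" for g
    using that vertex_on_edge[OF gp', of g p] pP by (auto simp: edges_def)
  have F3: "x = a \<and> a \<in> f \<and> a \<in> g" if "a \<in> P" "f \<in> edges P" "g \<in> edges P" "f \<noteq> g" 
    "x \<in> convex hull {p, a}" "x \<in> convex hull f" "x \<in> convex hull g" for a f g x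
  proof -
    have "x \<in> Y" using that by (auto simp: Y_def)
    moreover have "orient a x p = 0"
      using that orient_segment_zero[of x p a] by (simp add: orient_cycle[of a x p] segment_convex_hull)
    ultimately have "x = a" using pY[of a x] that by auto
    then show ?thesis using that vertex_on_edge[OF gp] by auto
  qed
  have "x \<in> e \<inter> f \<inter> g" if *: "e \<in> edges (insert p P)" "f \<in> edges (insert p P)" "g \<in> edges (insert p P)" 
    "e \<noteq> f" "e \<noteq> g" "f \<noteq> g" "x \<in> convex hull e" "x \<in> convex hull f" "x \<in> convex hull g" for e f g x
  proof -
    have two: "x \<in> {p, a} \<inter> {p, b} \<inter> h" if "a \<in> P" "b \<in> P" "{p, a} \<noteq> {p, b}" "h \<in> edges (insert p P)"
      "x \<in> convex hull {p, a}" "x \<in> convex hull {p, b}" "x \<in> convex hull h" for a b h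
    proof -
      have "x = p" using F1 that by blast
      with that F2 edges_cases[of h] show ?thesis by auto
    qed
    from edges_cases[OF *(1)] edges_cases[OF *(2)] edges_cases[OF *(3)] show ?thesis
    proof (elim disjE bexE)
      assume "e \<in> edges P" "f \<in> edges P" "g \<in> edges P"
      then show ?thesis using conc * by blast
    next
      fix a assume "e \<in> edges P" "f \<in> edges P" "a \<in> P" "g = {p, a}"
      then show ?thesis using F3[of a e f x] * by auto
    next
      fix a assume "e \<in> edges P" "a \<in> P" "f = {p, a}" "g \<in> edges P" 
      then show ?thesis using F3[of a e g x] * by auto
    next
      fix a assume "a \<in> P" "e = {p, a}" "f \<in> edges P" "g \<in> edges P" 
      then show ?thesis using F3[of a f g x] * by auto
    next
      fix a b assume "e \<in> edges P" "a \<in> P" "f = {p, a}" "b \<in> P" "g = {p, b}"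
      then show ?thesis using two[of a b e] * by auto
    next
      fix a b assume "a \<in> P" "e = {p, a}" "f \<in> edges P" "b \<in> P" "g = {p, b}"
      then show ?thesis using two[of a b f] * by auto
    next
      fix a b assume "a \<in> P" "e = {p, a}" "b \<in> P" "f = {p, b}" "g \<in> edges P"
      then show ?thesis using two[of a b g] * by auto
    next
      fix a b c assume "a \<in> P" "e = {p, a}" "b \<in> P" "f = {p, b}" "c \<in> P" "g = {p, c}"
      then show ?thesis using two[of a b g] * by auto
    qed
  qed
  then have "rectilinear_drawing (Suc n) (insert p P)"
    unfolding rectilinear_drawing_iff using gp' fin card pP by auto
  with p(1) p1 show thesis by (rule that)
qed

text \<open>The centres \<open>f i\<close> are arbitrary and may coincide, so this also yields the
  existence of drawings with any number of vertices.\<close>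

lemma perturb_to_drawing:
  fixes f :: "'a \<Rightarrow> real^2"
  assumes "finite I" "0 < \<epsilon>"
  shows "\<exists>g. (\<forall>i\<in>I. dist (g i) (f i) < \<epsilon>) \<and> inj_on (\<lambda>i. g i $ 1) I \<and> rectilinear_drawing (card I) (g ` I)"
  using assms(1)
proof (induction I)
  case empty
  show ?case by (simp add: rectilinear_drawing_def edges_def)
next
  case (insert i I)
  then obtain g where g: "\<forall>i\<in>I. dist (g i) (f i) < \<epsilon>" "inj_on (\<lambda>i. g i $ 1) I" 
    "rectilinear_drawing (card I) (g ` I)" by blast
  obtain p where p: "dist p (f i) < \<epsilon>" "p$1 \<notin> (\<lambda>q. q$1) ` g ` I" 
    "rectilinear_drawing (Suc (card I)) (insert p (g ` I))"
    using drawing_extend[OF g(3) assms(2)] .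
  have im: "g(i := p) ` I = g ` I" using insert.hyps by auto
  have "inj_on (\<lambda>j. (g(i := p)) j $ 1) I \<longleftrightarrow> inj_on (\<lambda>j. g j $ 1) I"
    using insert.hyps by (intro inj_on_cong) auto
  then have "inj_on (\<lambda>j. (g(i := p)) j $ 1) (insert i I)"
    using g(2) p(2) insert.hyps by (auto simp: image_iff)
  with p g im insert.hyps show ?case
    by (intro exI[of _ "g(i := p)"]) auto
qed

lemma eventually_sgn_eq:
  fixes f :: "'b \<Rightarrow> real"
  assumes "(f \<longlongrightarrow> L) F" "L \<noteq> 0"
  shows "\<forall>\<^sub>F x in F. sgn (f x) = sgn L"
proof (cases "L > 0")
  case True
  from order_tendstoD(1)[OF assms(1) True] show ?thesis 
    by eventually_elim (use True in simp)
next
  case False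
  with assms have "L < 0" by simp
  from order_tendstoD(2)[OF assms(1) this] show ?thesis 
    by eventually_elim (use \<open>L < 0\<close> in simp)
qed

text \<open>Nonzero orientations keep their sign under small perturbations, and triples with a
  repeated index give zero on both sides. One sufficiently fine perturbation serves all finitely
  many triples.\<close>

lemma drawing_same_orientations:
  assumes fin: "finite I" and gp: "in_general_position I f"
  shows "\<exists>g. inj_on (\<lambda>i. g i $ 1) I \<and> rectilinear_drawing (card I) (g ` I) \<and>
    (\<forall>a\<in>I. \<forall>b\<in>I. \<forall>c\<in>I. sgn (orient_of g a b c) = sgn (orient_of f a b c))"
proof -
  have "\<forall>n. \<exists>g. (\<forall>i\<in>I. dist (g i) (f i) < inverse (real (Suc n))) \<and> inj_on (\<lambda>i. g i $ 1) I \<and> 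
    rectilinear_drawing (card I) (g ` I)"
    using perturb_to_drawing[OF fin] by simp
  then obtain g where g: "\<And>n i. i \<in> I \<Longrightarrow> dist (g n i) (f i) < inverse (real (Suc n))" 
    "\<And>n. inj_on (\<lambda>i. g n i $ 1) I" "\<And>n. rectilinear_drawing (card I) (g n ` I)"
    by metis
  have lim: "(\<lambda>n. g n i) \<longlonglongrightarrow> f i" if "i \<in> I" for i
  proof (rule metric_tendsto_imp_tendsto[OF LIMSEQ_inverse_real_of_nat])
    show "\<forall>\<^sub>F n in sequentially. dist (g n i) (f i) \<le> dist (inverse (real (Suc n))) 0"
      using g(1)[OF that] by (intro always_eventually allI) (simp add: less_imp_le del: of_nat_Suc)
  qed
  have "\<forall>\<^sub>F n in sequentially. sgn (orient_of (g n) a b c) = sgn (orient_of f a b c)"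
    if abc: "a \<in> I" "b \<in> I" "c \<in> I" for a b c
  proof (cases "distinct [a, b, c]")
    case True
    have "(\<lambda>n. orient_of (g n) a b c) \<longlonglongrightarrow> orient_of f a b c"
      unfolding orient_of_def orient_def by (intro tendsto_intros lim abc)
    then show ?thesis
      by (rule eventually_sgn_eq) (use orient_nonzero[OF gp abc True] in \<open>simp add: orient_of_def\<close>)
  next
    case False
    then show ?thesis by (auto simp: orient_of_def)
  qed
  then have "\<forall>\<^sub>F n in sequentially. \<forall>a\<in>I. \<forall>b\<in>I. \<forall>c\<in>I. sgn (orient_of (g n) a b c) = sgn (orient_of f a b c)"
    using fin by (simp add: eventually_ball_finite)
  from eventually_happens'[OF sequentially_bot this]
  obtain n where "\<forall>a\<in>I. \<forall>b\<in>I. \<forall>c\<in>I. sgn (orient_of (g n) a b c) = sgn (orient_of f a b c)"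
    by blast
  with g show ?thesis by blast
qed

section \<open>The crossing number as an attained minimum\<close>

lemma rectilinear_drawingD:
  assumes "rectilinear_drawing n P"
  shows "finite P" "card P = n" "in_general_position P id"
  using assms unfolding rectilinear_drawing_iff by blast+

lemma crossing_number_le:
  "rectilinear_drawing n P \<Longrightarrow> rectilinear_crossing_number n \<le> card (edge_crossings P)"
  unfolding rectilinear_crossing_number_def by (rule Least_le) blast

lemma crossing_number_attained:
  obtains P where "rectilinear_drawing n P" "card (edge_crossings P) = rectilinear_crossing_number n"
proof -
  obtain P where P: "rectilinear_drawing n P"
    using perturb_to_drawing[of "{..<n}" 1 "\<lambda>_. 0"] by auto
  have "\<exists>P. rectilinear_drawing n P \<and> card (edge_crossings P) = rectilinear_crossing_number n"
    unfolding rectilinear_crossing_number_def by (rule LeastI_ex) (use P in blast)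
  with that show thesis by blast
qed

text \<open>Triple points are removed by a perturbation that changes no orientation. A blow-up can
  therefore be used without checking that it is itself a drawing.\<close>

lemma separations_plus_crossing_number_le:
  assumes fin: "finite I" and gp: "in_general_position I f"
  shows "real (separations I (orient_of f)) + 2 * real (rectilinear_crossing_number (card I)) 
    \<le> 6 * real (card I choose 4)"
proof -
  obtain g where g: "inj_on (\<lambda>i. g i $ 1) I" "rectilinear_drawing (card I) (g ` I)" 
    "\<forall>a\<in>I. \<forall>b\<in>I. \<forall>c\<in>I. sgn (orient_of g a b c) = sgn (orient_of f a b c)"
    using drawing_same_orientations[OF assms] by blast
  have inj: "inj_on g I" using g(1) by (auto simp: inj_on_def)
  have "separations I (orient_of f) = separations I (orient_of g)" 
    by (rule separations_cong) (use g(3) in auto)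
  also have "\<dots> = separations (g ` I) orient" by (rule separations_image[OF inj, symmetric])
  finally show ?thesis
    using separations_plus_crossings[OF rectilinear_drawingD(3,1)[OF g(2)]] crossing_number_le[OF g(2)]
      card_image[OF inj] by simp
qed

text \<open>Numbering the vertices by first coordinate turns the comparison of positions along a
  flattened copy into a comparison of indices.\<close>

lemma optimal_drawing_sorted:
  obtains g :: "nat \<Rightarrow> real^2" where "\<And>i j. i < j \<Longrightarrow> j < n \<Longrightarrow> g i $ 1 < g j $ 1"
    "in_general_position {..<n} g"
    "real (separations {..<n} (orient_of g)) + 2 * real (rectilinear_crossing_number n) = 6 * real (n choose 4)"
proof -
  obtain P where P: "rectilinear_drawing n P" "card (edge_crossings P) = rectilinear_crossing_number n"
    by (rule crossing_number_attained)
  note fin = rectilinear_drawingD(1)[OF P(1)] and card = rectilinear_drawingD(2)[OF P(1)]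
    and gp = rectilinear_drawingD(3)[OF P(1)]
  \<comment> \<open>An optimal drawing may have vertices with equal first coordinates; the perturbed
    one has the same separations.\<close>
  obtain h where h: "inj_on (\<lambda>i. h i $ 1) P" "rectilinear_drawing n (h ` P)" 
    "\<forall>a\<in>P. \<forall>b\<in>P. \<forall>c\<in>P. sgn (orient_of h a b c) = sgn (orient_of id a b c)"
    using drawing_same_orientations[OF fin gp] card by blast
  have inj: "inj_on h P" using h(1) by (auto simp: inj_on_def)
  have "separations (h ` P) orient = separations P (orient_of h)" by (rule separations_image[OF inj])
  also have "\<dots> = separations P (orient_of id)" by (rule separations_cong) (use h(3) in auto)
  also have "orient_of id = orient" by (simp add: fun_eq_iff orient_of_def)
  finally have sep: "separations (h ` P) orient = separations P orient" .
  define X where "X = (\<lambda>p. p $ 1) ` h ` P"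
  have injx: "inj_on (\<lambda>p. p $ 1) (h ` P)" using h(1) by (auto simp: inj_on_def)
  have X: "finite X" "card X = n" 
    using fin card card_image[OF inj] card_image[OF injx] by (auto simp: X_def)
  define xs where "xs = sorted_list_of_set X"
  have xs: "length xs = n" "set xs = X" "sorted_wrt (<) xs" "distinct xs"
    using X by (auto simp: xs_def strict_sorted_list_of_set)
  define g where "g i = inv_into (h ` P) (\<lambda>p. p $ 1) (xs ! i)" for i
  have g: "g i \<in> h ` P" "g i $ 1 = xs ! i" if "i < n" for i
  proof -
    have "xs ! i \<in> (\<lambda>p. p $ 1) ` h ` P" using that xs nth_mem[of i xs] by (simp add: X_def)
    then show "g i \<in> h ` P" "g i $ 1 = xs ! i"
      unfolding g_def by (rule inv_into_into, rule f_inv_into_f)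
  qed
  have mono: "g i $ 1 < g j $ 1" if "i < j" "j < n" for i j
    using that xs g by (simp add: sorted_wrt_nth_less)
  have injg: "inj_on g {..<n}"
  proof (rule inj_onI)
    fix i j assume "i \<in> {..<n}" "j \<in> {..<n}" "g i = g j"
    then show "i = j" using mono[of i j] mono[of j i] by (cases i j rule: linorder_cases) auto
  qed
  have img: "g ` {..<n} = h ` P"
    by (rule card_subset_eq) (use g fin card_image[OF injg] card_image[OF inj] card in auto)
  have "in_general_position (h ` P) id" by (rule rectilinear_drawingD(3)[OF h(2)])
  then have gpg: "in_general_position {..<n} g"
    unfolding img[symmetric] in_general_position_def using injg by (auto simp: inj_on_eq_iff)
  have "separations {..<n} (orient_of g) = separations P orient"
    using separations_image[OF injg] sep by (simp add: img)
  then have "real (separations {..<n} (orient_of g)) + 2 * real (rectilinear_crossing_number n) 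
    = 6 * real (n choose 4)"
    using separations_plus_crossings[OF gp fin] card P(2) by simp
  with mono gpg show thesis by (rule that)
qed

lemma in_general_position_subset:
  "in_general_position I f \<Longrightarrow> J \<subseteq> I \<Longrightarrow> in_general_position J f"
  unfolding in_general_position_def by (meson inj_on_subset subsetD)

lemma rectilinear_drawing_remove:
  assumes dr: "rectilinear_drawing (Suc n) P" and p: "p \<in> P"
  shows "rectilinear_drawing n (P - {p})"
proof -
  have sub: "edges (P - {p}) \<subseteq> edges P" by (auto simp: edges_def)
  have conc: "x \<in> e \<inter> f \<inter> g" if "e \<in> edges P" "f \<in> edges P" "g \<in> edges P" "e \<noteq> f \<and> e \<noteq> g \<and> f \<noteq> g"
    "x \<in> convex hull e \<inter> convex hull f \<inter> convex hull g" for e f g x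
    using dr that unfolding rectilinear_drawing_def by blast
  show ?thesis unfolding rectilinear_drawing_iff
  proof (intro conjI ballI impI)
    show "finite (P - {p})" "card (P - {p}) = n" 
      using p rectilinear_drawingD(1,2)[OF dr] by auto
    show "in_general_position (P - {p}) id" 
      using rectilinear_drawingD(3)[OF dr] by (rule in_general_position_subset) auto
    fix e f g x assume E: "e \<in> edges (P - {p})" "f \<in> edges (P - {p})" "g \<in> edges (P - {p})" 
      "e \<noteq> f \<and> e \<noteq> g \<and> f \<noteq> g" "x \<in> convex hull e \<inter> convex hull f \<inter> convex hull g"
    show "x \<in> e \<inter> f \<inter> g"
      by (rule conc[OF subsetD[OF sub E(1)] subsetD[OF sub E(2)] subsetD[OF sub E(3)] E(4,5)])
  qed
qed

text \<open>Each crossing survives the deletion of a vertex for all but four vertices.\<close>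

lemma crossing_number_Suc:
  "real (Suc n) * real (rectilinear_crossing_number n) 
    \<le> (real n - 3) * real (rectilinear_crossing_number (Suc n))"
proof -
  obtain P where P: "rectilinear_drawing (Suc n) P" 
    "card (edge_crossings P) = rectilinear_crossing_number (Suc n)"
    by (rule crossing_number_attained)
  note fin = rectilinear_drawingD(1)[OF P(1)] and card = rectilinear_drawingD(2)[OF P(1)]
    and gp = rectilinear_drawingD(3)[OF P(1)]
  define A where "A Q = {(a, b, c, d). a \<in> Q \<and> b \<in> Q \<and> c \<in> Q \<and> d \<in> Q \<and> crosses a b c d}" for Q
  define V where "V = (\<lambda>(a, b, c, d). {a, b, c, d :: real^2})"
  have cardA: "card (A Q) = 8 * card (edge_crossings Q)" if "in_general_position Q id" "finite Q" for Q
    unfolding A_def by (rule card_crossing_tuples[OF that])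
  have "A P \<subseteq> P \<times> P \<times> P \<times> P" by (auto simp: A_def)
  then have finA: "finite (A P)" using fin by (meson finite_SigmaI finite_subset)
  have 1: "8 * rectilinear_crossing_number n \<le> card {t \<in> A P. p \<notin> V t}" if "p \<in> P" for p
  proof -
    have dr: "rectilinear_drawing n (P - {p})" using P(1) that by (rule rectilinear_drawing_remove)
    then have "8 * rectilinear_crossing_number n \<le> card (A (P - {p}))"
      using cardA[OF rectilinear_drawingD(3,1)[OF dr]] crossing_number_le[OF dr] by simp
    also have "A (P - {p}) = {t \<in> A P. p \<notin> V t}" by (auto simp: A_def V_def)
    finally show ?thesis .
  qed
  \<comment> \<open>Of the \<open>n + 1\<close> vertices all but the four endpoints can be deleted,
    which leaves \<open>n - 3\<close>.\<close>
  have 2: "real (card {p \<in> P. p \<notin> V t}) = real n - 3" if tA: "t \<in> A P" for t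
  proof -
    obtain a b c d where t: "t = (a, b, c, d)" "a \<in> P" "b \<in> P" "c \<in> P" "d \<in> P" "crosses a b c d"
      using tA by (auto simp: A_def)
    then have "card (V t) = 4" using crosses_distinct[of a b c d] by (simp add: V_def)
    moreover have sub: "V t \<subseteq> P" using t by (auto simp: V_def)
    moreover have "{p \<in> P. p \<notin> V t} = P - V t" by auto
    ultimately show ?thesis
      using card fin card_mono[OF fin sub] by (simp add: card_Diff_subset finite_subset[OF sub] of_nat_diff)
  qed
  have "real (Suc n) * (8 * real (rectilinear_crossing_number n)) = 
    (\<Sum>p\<in>P. real (8 * rectilinear_crossing_number n))"
    by (simp add: card)
  also have "\<dots> \<le> (\<Sum>p\<in>P. real (card {t \<in> A P. p \<notin> V t}))"
    by (intro sum_mono of_nat_mono 1)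
  also have "\<dots> = (\<Sum>p\<in>P. \<Sum>t\<in>A P. of_bool (p \<notin> V t))"
    using finA by (simp add: sum_of_bool_eq Int_def)
  also have "\<dots> = (\<Sum>t\<in>A P. \<Sum>p\<in>P. of_bool (p \<notin> V t))" by (rule sum.swap)
  also have "\<dots> = (\<Sum>t\<in>A P. real (card {p \<in> P. p \<notin> V t}))"
    using fin by (simp add: sum_of_bool_eq Int_def)
  also have "\<dots> = 8 * real (rectilinear_crossing_number (Suc n)) * (real n - 3)"
    using 2 cardA[OF gp fin] P(2) by simp
  finally show ?thesis by (simp add: algebra_simps)
qed

subsection \<open>Substituting flattened copies\<close>

text \<open>Each point \<open>P i\<close> is replaced by a copy of \<open>D\<close> scaled by \<open>\<epsilon>\<close> along \<open>u i\<close> and by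
  \<open>\<epsilon>\<^sup>2\<close> across it, so that for small \<open>\<epsilon>\<close> every line spanned by the copy is close to the line
  through \<open>P i\<close> in direction \<open>u i\<close>.\<close>

lemma flattened_copies:
  fixes P u :: "'i \<Rightarrow> real^2" and D :: "nat \<Rightarrow> real^2"
  assumes fin: "finite I" and gp: "in_general_position I P"
    and D: "inj_on (\<lambda>x. D x $ 1) {..<k}"
    and u: "\<And>i. i \<in> I \<Longrightarrow> u i \<noteq> 0"
    and s: "\<And>i j. i \<in> I \<Longrightarrow> j \<in> I \<Longrightarrow> i \<noteq> j \<Longrightarrow> orient (P i) (P i + u i) (P j) \<noteq> 0"
  obtains q where
    "\<And>i j l x y z. i \<in> I \<Longrightarrow> j \<in> I \<Longrightarrow> l \<in> I \<Longrightarrow> distinct [i, j, l] \<Longrightarrow> x < k \<Longrightarrow> y < k \<Longrightarrow> z < k \<Longrightarrow>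
       sgn (orient (q (i, x)) (q (j, y)) (q (l, z))) = sgn (orient (P i) (P j) (P l))"
    "\<And>i j x y z. i \<in> I \<Longrightarrow> j \<in> I \<Longrightarrow> i \<noteq> j \<Longrightarrow> x < k \<Longrightarrow> y < k \<Longrightarrow> z < k \<Longrightarrow>
       sgn (orient (q (i, x)) (q (i, y)) (q (j, z))) = 
       sgn (D y $ 1 - D x $ 1) * sgn (orient (P i) (P i + u i) (P j))"
    "\<And>i x y z. i \<in> I \<Longrightarrow> x < k \<Longrightarrow> y < k \<Longrightarrow> z < k \<Longrightarrow>
       sgn (orient (q (i, x)) (q (i, y)) (q (i, z))) = sgn (orient (D x) (D y) (D z))"
proof -
  \<comment> \<open>One factor \<open>\<epsilon>\<close> is left to \<open>Q\<close>, so
    \<open>w\<close> tends to a multiple of \<open>u i\<close> while the displacement across the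
    line has order \<open>\<epsilon>\<close> squared.\<close>
  define w :: "real \<Rightarrow> 'i \<Rightarrow> nat \<Rightarrow> real^2" where 
    "w \<epsilon> i x = (D x $ 1) *\<^sub>R u i + (\<epsilon> * D x $ 2) *\<^sub>R vector [- (u i $ 2), u i $ 1]" for \<epsilon> i x
  define Q where "Q \<epsilon> = (\<lambda>(i, x). P i + \<epsilon> *\<^sub>R w \<epsilon> i x)" for \<epsilon>
  define K where "K = {..<k}"
  have [simp]: "finite K" "\<And>x. x \<in> K \<longleftrightarrow> x < k" by (auto simp: K_def)
  have e0: "((\<lambda>\<epsilon>. \<epsilon>) \<longlongrightarrow> 0) (at_right (0::real))" by (rule tendsto_ident_at)
  have w_lim: "((\<lambda>\<epsilon>. w \<epsilon> i x $ n) \<longlongrightarrow> D x $ 1 * u i $ n) (at_right 0)" for i x n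
    unfolding w_def by (auto intro!: tendsto_eq_intros e0)
  have Q_lim: "((\<lambda>\<epsilon>. Q \<epsilon> (i, x) $ n) \<longlongrightarrow> P i $ n) (at_right 0)" for i x n
  proof -
    have "((\<lambda>\<epsilon>. P i $ n + \<epsilon> * w \<epsilon> i x $ n) \<longlongrightarrow> P i $ n + 0 * (D x $ 1 * u i $ n)) (at_right 0)"
      by (intro tendsto_add tendsto_const tendsto_mult e0 w_lim)
    then show ?thesis by (simp add: Q_def)
  qed
  have pos: "\<forall>\<^sub>F \<epsilon> in at_right (0::real). 0 < \<epsilon>" by (rule eventually_at_right_less)
  have 1: "\<forall>\<^sub>F \<epsilon> in at_right 0. distinct [i, j, l] \<longrightarrow>
      sgn (orient (Q \<epsilon> (i, x)) (Q \<epsilon> (j, y)) (Q \<epsilon> (l, z))) = sgn (orient (P i) (P j) (P l))"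
    if "i \<in> I" "j \<in> I" "l \<in> I" for i j l x y z
  proof (cases "distinct [i, j, l]")
    case True
    have "((\<lambda>\<epsilon>. orient (Q \<epsilon> (i, x)) (Q \<epsilon> (j, y)) (Q \<epsilon> (l, z))) \<longlongrightarrow> orient (P i) (P j) (P l)) (at_right 0)"
      unfolding orient_def by (intro tendsto_intros Q_lim)
    from eventually_sgn_eq[OF this orient_nonzero[OF gp that True]] show ?thesis
      by eventually_elim simp
  next
    case False
    then show ?thesis by (intro always_eventually allI impI) simp
  qed
  have 2: "\<forall>\<^sub>F \<epsilon> in at_right 0. i \<noteq> j \<longrightarrow> sgn (orient (Q \<epsilon> (i, x)) (Q \<epsilon> (i, y)) (Q \<epsilon> (j, z))) = 
       sgn (D y $ 1 - D x $ 1) * sgn (orient (P i) (P i + u i) (P j))"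
    if "i \<in> I" "j \<in> I" "x \<in> K" "y \<in> K" for i j x y z
  proof (cases "i \<noteq> j \<and> x \<noteq> y")
    case True
    then have ne: "D y $ 1 - D x $ 1 \<noteq> 0" using that D by (auto simp: inj_on_def)
    \<comment> \<open>The orientation divided by \<open>\<epsilon>\<close>: it tends to zero itself,
      so its sign is read off from the rescaled limit.\<close>
    define H where "H \<epsilon> = (w \<epsilon> i y $ 1 - w \<epsilon> i x $ 1) * (Q \<epsilon> (j, z) $ 2 - Q \<epsilon> (i, x) $ 2)
      - (w \<epsilon> i y $ 2 - w \<epsilon> i x $ 2) * (Q \<epsilon> (j, z) $ 1 - Q \<epsilon> (i, x) $ 1)" for \<epsilon>
    have "(H \<longlongrightarrow> (D y $ 1 * u i $ 1 - D x $ 1 * u i $ 1) * (P j $ 2 - P i $ 2)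
      - (D y $ 1 * u i $ 2 - D x $ 1 * u i $ 2) * (P j $ 1 - P i $ 1)) (at_right 0)"
      unfolding H_def by (intro tendsto_intros Q_lim w_lim)
    also have "(D y $ 1 * u i $ 1 - D x $ 1 * u i $ 1) * (P j $ 2 - P i $ 2)
      - (D y $ 1 * u i $ 2 - D x $ 1 * u i $ 2) * (P j $ 1 - P i $ 1)
      = (D y $ 1 - D x $ 1) * orient (P i) (P i + u i) (P j)"
      by (simp add: orient_def algebra_simps)
    finally have "\<forall>\<^sub>F \<epsilon> in at_right 0. sgn (H \<epsilon>) = sgn ((D y $ 1 - D x $ 1) * orient (P i) (P i + u i) (P j))"
      by (rule eventually_sgn_eq) (use ne s that True in auto)
    with pos show ?thesis
    proof eventually_elim
      case (elim \<epsilon>)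
      have "orient (Q \<epsilon> (i, x)) (Q \<epsilon> (i, y)) (Q \<epsilon> (j, z)) = \<epsilon> * H \<epsilon>"
        by (simp add: orient_def H_def Q_def algebra_simps)
      with elim show ?case by (simp add: sgn_mult)
    qed
  qed auto
  have 3: "\<forall>\<^sub>F \<epsilon> in at_right 0. \<forall>i\<in>I. \<forall>x\<in>K. \<forall>y\<in>K. \<forall>z\<in>K. 
    sgn (orient (Q \<epsilon> (i, x)) (Q \<epsilon> (i, y)) (Q \<epsilon> (i, z))) = sgn (orient (D x) (D y) (D z))"
    using pos
  proof eventually_elim
    case (elim \<epsilon>)
    \<comment> \<open>The copy is an affine image of \<open>D\<close> with determinant
      \<open>\<epsilon> * \<epsilon>^2\<close> times the squared length of \<open>u i\<close>, which
      is positive.\<close>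
    have "orient (Q \<epsilon> (i, x)) (Q \<epsilon> (i, y)) (Q \<epsilon> (i, z)) = 
      \<epsilon>^3 * ((u i $ 1)^2 + (u i $ 2)^2) * orient (D x) (D y) (D z)" for i x y z
      by (simp add: orient_def Q_def w_def power2_eq_square power3_eq_cube) (simp add: algebra_simps)
    moreover have "(u i $ 1)^2 + (u i $ 2)^2 > 0" if "i \<in> I" for i
      using u[OF that] by (auto simp: vec_eq_iff forall_2 sum_power2_gt_zero_iff)
    ultimately show ?case using elim by (simp add: sgn_mult)
  qed
  have "\<forall>\<^sub>F \<epsilon> in at_right 0. 
    (\<forall>i\<in>I. \<forall>j\<in>I. \<forall>l\<in>I. \<forall>x\<in>K. \<forall>y\<in>K. \<forall>z\<in>K. distinct [i, j, l] \<longrightarrow>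
      sgn (orient (Q \<epsilon> (i, x)) (Q \<epsilon> (j, y)) (Q \<epsilon> (l, z))) = sgn (orient (P i) (P j) (P l))) \<and>
    (\<forall>i\<in>I. \<forall>j\<in>I. \<forall>x\<in>K. \<forall>y\<in>K. \<forall>z\<in>K. i \<noteq> j \<longrightarrow> 
      sgn (orient (Q \<epsilon> (i, x)) (Q \<epsilon> (i, y)) (Q \<epsilon> (j, z))) = 
       sgn (D y $ 1 - D x $ 1) * sgn (orient (P i) (P i + u i) (P j))) \<and>
    (\<forall>i\<in>I. \<forall>x\<in>K. \<forall>y\<in>K. \<forall>z\<in>K. 
      sgn (orient (Q \<epsilon> (i, x)) (Q \<epsilon> (i, y)) (Q \<epsilon> (i, z))) = sgn (orient (D x) (D y) (D z)))"
    by (intro eventually_conj eventually_ball_finite fin \<open>finite K\<close> ballI 1 2 3)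
  from eventually_happens'[OF _ this] obtain \<epsilon> where
    q1: "\<forall>i\<in>I. \<forall>j\<in>I. \<forall>l\<in>I. \<forall>x\<in>K. \<forall>y\<in>K. \<forall>z\<in>K. distinct [i, j, l] \<longrightarrow>
      sgn (orient (Q \<epsilon> (i, x)) (Q \<epsilon> (j, y)) (Q \<epsilon> (l, z))) = sgn (orient (P i) (P j) (P l))"
    and q2: "\<forall>i\<in>I. \<forall>j\<in>I. \<forall>x\<in>K. \<forall>y\<in>K. \<forall>z\<in>K. i \<noteq> j \<longrightarrow> 
      sgn (orient (Q \<epsilon> (i, x)) (Q \<epsilon> (i, y)) (Q \<epsilon> (j, z))) = 
       sgn (D y $ 1 - D x $ 1) * sgn (orient (P i) (P i + u i) (P j))"
    and q3: "\<forall>i\<in>I. \<forall>x\<in>K. \<forall>y\<in>K. \<forall>z\<in>K. 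
      sgn (orient (Q \<epsilon> (i, x)) (Q \<epsilon> (i, y)) (Q \<epsilon> (i, z))) = sgn (orient (D x) (D y) (D z))"
    by (auto simp: trivial_limit_at_right_real)
  show thesis
    by (rule that[of "Q \<epsilon>"]; (rule q1[rule_format] | rule q2[rule_format] | rule q3[rule_format]); simp)
qed

section \<open>Separation counts in the blow-up\<close>

lemma lefts_plus_rights:
  assumes fin: "finite I" and gp: "in_general_position I f" and ab: "a \<in> I" "b \<in> I" "a \<noteq> b"
  shows "real (lefts I (orient_of f) a b) + real (rights I (orient_of f) a b) = real (card I) - 2"
proof -
  have "{c \<in> I. 0 < orient_of f a b c} \<union> {c \<in> I. orient_of f a b c < 0} = I - {a, b}"
    using orient_nonzero[OF gp ab(1,2)] ab(3) by (force simp: orient_of_def)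
  moreover have "{c \<in> I. 0 < orient_of f a b c} \<inter> {c \<in> I. orient_of f a b c < 0} = {}" by auto
  ultimately have "card (I - {a, b}) = lefts I (orient_of f) a b + rights I (orient_of f) a b"
    using fin by (simp add: lefts_def rights_def card_Un_disjoint[symmetric])
  moreover have "card (I - {a, b}) + 2 = card I"
    using card_Diff_subset[of "{a, b}" I] card_mono[of I "{a, b}"] ab fin by auto
  ultimately show ?thesis by linarith
qed

lemma card_slices:
  assumes "finite I" "finite K"
  shows "card {c \<in> I \<times> K. Q c} = (\<Sum>l\<in>I. card {z \<in> K. Q (l, z)})"
proof -
  have "{c \<in> I \<times> K. Q c} = (SIGMA l:I. {z \<in> K. Q (l, z)})" by auto
  then show ?thesis using assms by simp
qed

lemma sum_linear_product:
  fixes \<alpha> \<beta> :: real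
  shows "(\<Sum>y<k. (\<alpha> + real y) * (\<beta> - real y)) = 
    k * \<alpha> * \<beta> + (\<beta> - \<alpha>) * (k * (real k - 1) / 2) - k * (real k - 1) * (2 * real k - 1) / 6"
  by (induction k) (simp_all add: field_simps)

text \<open>For a line joining two copies, \<open>L\<close> and \<open>R\<close> count the copies on
  its two sides, and \<open>x\<close>, \<open>y\<close> count points of the two joined copies on one
  side. Only \<open>L * R\<close> and \<open>L + R\<close> survive the summation.\<close>

lemma sum_uniform_ranks:
  fixes L R :: real
  shows "(\<Sum>x<k. \<Sum>y<k. (k * L + real x + real y) * (k * R + (real k - 1 - real x) + (real k - 1 - real y))) =
    real k^4 * (L * R) + real k^3 * (real k - 1) * (L + R) + real k^2 * (real k - 1) * (5 * real k - 7) / 6"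
proof -
  define c where "c = k * R + 2 * (real k - 1)"
  have S: "(\<Sum>x<k. real x) = k * (real k - 1) / 2"
    by (induction k) (simp_all add: field_simps)
  have "(\<Sum>x<k. \<Sum>y<k. (k * L + real x + real y) * (k * R + (real k - 1 - real x) + (real k - 1 - real y))) =
    (\<Sum>x<k. \<Sum>y<k. ((k * L + real x) + real y) * ((c - real x) - real y))"
    by (intro sum.cong refl) (simp add: c_def algebra_simps)
  also have "\<dots> = (\<Sum>x<k. k * ((k * L + real x) * (c - real x))
    + ((c - k * L) * (k * (real k - 1) / 2) - k * (real k - 1) * (2 * real k - 1) / 6)
    - real x * (k * (real k - 1)))"
    unfolding sum_linear_product by (intro sum.cong refl) (simp add: algebra_simps add_divide_distrib diff_divide_distrib)
  also have "\<dots> = k * (k * (k * L) * c + (c - k * L) * (k * (real k - 1) / 2) - k * (real k - 1) * (2 * real k - 1) / 6)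
    + k * ((c - k * L) * (k * (real k - 1) / 2) - k * (real k - 1) * (2 * real k - 1) / 6)
    - k * (real k - 1) / 2 * (k * (real k - 1))"
    by (simp only: sum.distrib sum_subtractf sum_distrib_left[symmetric] sum_distrib_right[symmetric] 
      sum_linear_product S sum_constant card_lessThan) (simp only: algebra_simps)
  also have "\<dots> = real k^4 * (L * R) + real k^3 * (real k - 1) * (L + R) + real k^2 * (real k - 1) * (5 * real k - 7) / 6"
    unfolding c_def by (simp add: field_simps power2_eq_square power3_eq_cube power4_eq_xxxx)
  finally show ?thesis .
qed

lemma sgn_eq_pos_iff: "sgn a = sgn b \<Longrightarrow> 0 < a \<longleftrightarrow> 0 < (b :: real)"
  by (metis sgn_1_pos)

lemma sgn_eq_neg_iff: "sgn a = sgn b \<Longrightarrow> a < 0 \<longleftrightarrow> (b :: real) < 0"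
  by (metis sgn_1_neg)

text \<open>The sign of \<open>s i j\<close> is the side of the line along copy \<open>i\<close> on which copy \<open>j\<close> lies. Both
  sides carry the same number \<open>h\<close> of copies; with unequal sides the count for pairs inside a copy
  would depend on more than the crossing number of \<open>D\<close>.\<close>

locale blow_up =
  fixes I :: "'i set" and P :: "'i \<Rightarrow> real^2" and s :: "'i \<Rightarrow> 'i \<Rightarrow> real" and h k :: nat
    and D :: "nat \<Rightarrow> real^2" and q :: "'i \<times> nat \<Rightarrow> real^2"
  assumes fin: "finite I" and three: "3 \<le> card I" and gp: "in_general_position I P"
    and gp_D: "in_general_position {..<k} D"
    and D_mono: "\<And>x y. x < y \<Longrightarrow> y < k \<Longrightarrow> D x $ 1 < D y $ 1"
    and s_nonzero: "\<And>i j. i \<in> I \<Longrightarrow> j \<in> I \<Longrightarrow> i \<noteq> j \<Longrightarrow> s i j \<noteq> 0"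
    and bisect: "\<And>i. i \<in> I \<Longrightarrow> card {j \<in> I - {i}. 0 < s i j} = h"
      "\<And>i. i \<in> I \<Longrightarrow> card {j \<in> I - {i}. s i j < 0} = h"
    and q_distinct: "\<And>i j l x y z. i \<in> I \<Longrightarrow> j \<in> I \<Longrightarrow> l \<in> I \<Longrightarrow> distinct [i, j, l] \<Longrightarrow> 
      x < k \<Longrightarrow> y < k \<Longrightarrow> z < k \<Longrightarrow>
      sgn (orient (q (i, x)) (q (j, y)) (q (l, z))) = sgn (orient (P i) (P j) (P l))"
    and q_pair: "\<And>i j x y z. i \<in> I \<Longrightarrow> j \<in> I \<Longrightarrow> i \<noteq> j \<Longrightarrow> x < k \<Longrightarrow> y < k \<Longrightarrow> z < k \<Longrightarrow>
       sgn (orient (q (i, x)) (q (i, y)) (q (j, z))) = sgn (D y $ 1 - D x $ 1) * sgn (s i j)"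
    and q_same: "\<And>i x y z. i \<in> I \<Longrightarrow> x < k \<Longrightarrow> y < k \<Longrightarrow> z < k \<Longrightarrow>
       sgn (orient (q (i, x)) (q (i, y)) (q (i, z))) = sgn (orient (D x) (D y) (D z))"
begin

abbreviation "J \<equiv> I \<times> {..<k}"
abbreviation "\<omega> \<equiv> orient_of q"

lemma D_less_iff: "x < k \<Longrightarrow> y < k \<Longrightarrow> D x $ 1 < D y $ 1 \<longleftrightarrow> x < y"
  using D_mono[of x y] D_mono[of y x] by (cases x y rule: linorder_cases) auto

lemma q_pair_pos:
  assumes "i \<in> I" "j \<in> I" "i \<noteq> j" "x < k" "y < k" "z < k"
  shows "0 < orient (q (i, x)) (q (i, y)) (q (j, z)) \<longleftrightarrow> (if 0 < s i j then x < y else y < x)"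
    "orient (q (i, x)) (q (i, y)) (q (j, z)) < 0 \<longleftrightarrow> (if 0 < s i j then y < x else x < y)"
proof -
  have *: "sgn (orient (q (i, x)) (q (i, y)) (q (j, z))) = sgn ((D y $ 1 - D x $ 1) * s i j)"
    using q_pair[OF assms] by (simp add: sgn_mult)
  show "0 < orient (q (i, x)) (q (i, y)) (q (j, z)) \<longleftrightarrow> (if 0 < s i j then x < y else y < x)"
    using assms s_nonzero[of i j] 
    by (simp add: sgn_eq_pos_iff[OF *] zero_less_mult_iff D_less_iff)
  show "orient (q (i, x)) (q (i, y)) (q (j, z)) < 0 \<longleftrightarrow> (if 0 < s i j then y < x else x < y)"
    using assms s_nonzero[of i j] 
    by (simp add: sgn_eq_neg_iff[OF *] mult_less_0_iff D_less_iff)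
qed

lemma q_nonzero:
  assumes "a \<in> J" "b \<in> J" "c \<in> J" "distinct [a, b, c]"
  shows "orient (q a) (q b) (q c) \<noteq> 0"
proof -
  have pair: "orient (q (i, x)) (q (i, y)) (q (j, z)) \<noteq> 0"
    if "i \<in> I" "j \<in> I" "i \<noteq> j" "x < k" "y < k" "z < k" "x \<noteq> y" for i j x y z
    using q_pair_pos[OF that(1-6)] that(7) by (auto split: if_splits)
  obtain i x j y l z where abc: "a = (i, x)" "b = (j, y)" "c = (l, z)"
    by (cases a, cases b, cases c) auto
  consider "distinct [i, j, l]" | "i = j" "j \<noteq> l" | "j = l" "l \<noteq> i" | "i = l" "l \<noteq> j" | "i = j" "j = l"
    by auto
  then show ?thesis
  proof cases
    case 1
    have "sgn (orient (q a) (q b) (q c)) = sgn (orient (P i) (P j) (P l))"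
      unfolding abc by (rule q_distinct) (use 1 assms abc in auto)
    moreover have "orient (P i) (P j) (P l) \<noteq> 0"
      by (rule orient_nonzero[OF gp]) (use 1 assms abc in auto)
    ultimately show ?thesis by (metis sgn_eq_0_iff)
  next
    case 2
    then show ?thesis using pair[of i l x y z] assms abc by auto
  next
    case 3
    then show ?thesis using pair[of j i y z x] assms abc orient_cycle[of "q b" "q c" "q a"] by auto
  next
    case 4
    then show ?thesis using pair[of l j z x y] assms abc orient_cycle[of "q a" "q b" "q c"] by auto
  next
    case 5
    have "sgn (orient (q a) (q b) (q c)) = sgn (orient (D x) (D y) (D z))"
      unfolding abc 5 by (rule q_same) (use 5 assms abc in auto)
    moreover have "orient (D x) (D y) (D z) \<noteq> 0"
      by (rule orient_nonzero[OF gp_D]) (use 5 assms abc in auto)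
    ultimately show ?thesis by (metis sgn_eq_0_iff)
  qed
qed

lemma gp_q: "in_general_position J q"
proof -
  have "inj_on q J"
  proof (rule inj_onI, rule ccontr)
    fix a b assume ab: "a \<in> J" "b \<in> J" "q a = q b" "a \<noteq> b"
    \<comment> \<open>Coinciding points would have zero orientation with a point of a further copy,
      which exists because there are at least three base points.\<close>
    have "\<not> I \<subseteq> {fst a, fst b}"
      using three card_mono[of "{fst a, fst b}" I] card_insert_le_m1[of 2 "{fst b}" "fst a"] by auto
    then obtain l where l: "l \<in> I" "l \<noteq> fst a" "l \<noteq> fst b" by auto
    have "orient (q a) (q b) (q (l, snd a)) \<noteq> 0"
      using ab l by (intro q_nonzero) auto
    then show False using ab(3) by simp
  qed
  then show ?thesis unfolding in_general_position_def using q_nonzero by auto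
qed

text \<open>For points \<open>(i, x)\<close> and \<open>(j, y)\<close> of different copies, the line joining them cuts copy \<open>i\<close>
  transversally at the \<open>x\<close>-th point, so the number of points of copy \<open>i\<close> on a given side is
  the rank of \<open>x\<close> counted from one of the two ends.\<close>

definition rk :: "bool \<Rightarrow> nat \<Rightarrow> nat" where
  "rk p x = (if p then x else k - Suc x)"

lemma card_rk: 
  assumes "x < k" "\<And>z. z < k \<Longrightarrow> Q z \<longleftrightarrow> (if p then z < x else x < z)"
  shows "card {z \<in> {..<k}. Q z} = rk p x"
proof -
  have "{z \<in> {..<k}. Q z} = (if p then {..<x} else {Suc x..<k})" using assms by auto
  then show ?thesis by (simp add: rk_def)
qed

lemma rk_not: "x < k \<Longrightarrow> real (rk (\<not> p) x) = real k - 1 - real (rk p x)"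
  by (auto simp: rk_def of_nat_diff)

text \<open>Counting from the other end permutes the ranks, so sums over a copy forget on which side
  the other copy lies.\<close>

lemma sum_rk: "(\<Sum>x<k. F (rk p x)) = (\<Sum>x<k. F x)"
  by (cases p) (simp_all add: rk_def sum.nat_diff_reindex)

lemma lefts_different:
  assumes "i \<in> I" "j \<in> I" "i \<noteq> j" "x < k" "y < k"
  shows "lefts J \<omega> (i, x) (j, y) = k * lefts I (orient_of P) i j + rk (0 < s i j) x + rk (\<not> 0 < s j i) y"
    "rights J \<omega> (i, x) (j, y) = k * rights I (orient_of P) i j + rk (\<not> 0 < s i j) x + rk (0 < s j i) y"
proof -
  have split: "(\<Sum>l\<in>I. F l) = (\<Sum>l\<in>I - {i, j}. F l) + F i + F j" for F :: "'i \<Rightarrow> nat"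
    using assms fin by (simp add: sum.remove[of I i] sum.remove[of "I - {i}" j] Diff_insert2[symmetric] insert_commute)
  have far: "sgn (\<omega> (i, x) (j, y) (l, z)) = sgn (orient_of P i j l)" if "l \<in> I - {i, j}" "z < k" for l z
    using q_distinct[of i j l x y z] that assms by (auto simp: orient_of_def)
  \<comment> \<open>After rotation the varying point stands first in copy \<open>i\<close> but
    second in copy \<open>j\<close>; hence the two ranks carry opposite conditions.\<close>
  have i: "\<omega> (i, x) (j, y) (i, z) = orient (q (i, z)) (q (i, x)) (q (j, y))" for z
    unfolding orient_of_def by (rule orient_cycle)
  have j: "\<omega> (i, x) (j, y) (j, z) = orient (q (j, y)) (q (j, z)) (q (i, x))" for z
    unfolding orient_of_def by (rule orient_cycle[symmetric])
  have ci: "card {z \<in> {..<k}. 0 < \<omega> (i, x) (j, y) (i, z)} = rk (0 < s i j) x"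
    "card {z \<in> {..<k}. \<omega> (i, x) (j, y) (i, z) < 0} = rk (\<not> 0 < s i j) x"
    by (rule card_rk; simp add: i q_pair_pos assms assms(3)[symmetric])+
  have cj: "card {z \<in> {..<k}. 0 < \<omega> (i, x) (j, y) (j, z)} = rk (\<not> 0 < s j i) y"
    "card {z \<in> {..<k}. \<omega> (i, x) (j, y) (j, z) < 0} = rk (0 < s j i) y"
    by (rule card_rk; simp add: j q_pair_pos assms assms(3)[symmetric])+
  have cl: "card {z \<in> {..<k}. 0 < \<omega> (i, x) (j, y) (l, z)} = k * of_bool (0 < orient_of P i j l)"
    "card {z \<in> {..<k}. \<omega> (i, x) (j, y) (l, z) < 0} = k * of_bool (orient_of P i j l < 0)"
    if "l \<in> I - {i, j}" for l
  proof -
    have "{z \<in> {..<k}. 0 < \<omega> (i, x) (j, y) (l, z)} = (if 0 < orient_of P i j l then {..<k} else {})"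
      "{z \<in> {..<k}. \<omega> (i, x) (j, y) (l, z) < 0} = (if orient_of P i j l < 0 then {..<k} else {})"
      using sgn_eq_pos_iff[OF far[OF that]] sgn_eq_neg_iff[OF far[OF that]] by auto
    then show "card {z \<in> {..<k}. 0 < \<omega> (i, x) (j, y) (l, z)} = k * of_bool (0 < orient_of P i j l)"
    "card {z \<in> {..<k}. \<omega> (i, x) (j, y) (l, z) < 0} = k * of_bool (orient_of P i j l < 0)" by simp_all
  qed
  have c0: "(\<Sum>l\<in>I - {i, j}. of_bool (Q (orient_of P i j l))) = card {l \<in> I. Q (orient_of P i j l)}" 
    if "\<not> Q 0" for Q :: "real \<Rightarrow> bool"
  proof -
    have "{l \<in> I. Q (orient_of P i j l)} = (I - {i, j}) \<inter> {l. Q (orient_of P i j l)}"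
      using that by (auto simp: orient_of_def)
    then show ?thesis using fin by (simp add: sum_of_bool_eq)
  qed
  have c1: "(\<Sum>l\<in>I - {i, j}. of_bool (0 < orient_of P i j l)) = lefts I (orient_of P) i j"
    "(\<Sum>l\<in>I - {i, j}. of_bool (orient_of P i j l < 0)) = rights I (orient_of P) i j"
    unfolding lefts_def rights_def using c0[of "\<lambda>t. 0 < t"] c0[of "\<lambda>t. t < 0"] by simp_all
  show "lefts J \<omega> (i, x) (j, y) = k * lefts I (orient_of P) i j + rk (0 < s i j) x + rk (\<not> 0 < s j i) y"
    unfolding lefts_def[of J] card_slices[OF fin finite_lessThan] split ci cj
    by (simp only: cl sum_distrib_left[symmetric] c1 cong: sum.cong)
  show "rights J \<omega> (i, x) (j, y) = k * rights I (orient_of P) i j + rk (\<not> 0 < s i j) x + rk (0 < s j i) y"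
    unfolding rights_def[of J] card_slices[OF fin finite_lessThan] split ci cj
    by (simp only: cl sum_distrib_left[symmetric] c1 cong: sum.cong)
qed

text \<open>By \<open>q_pair\<close> every other copy lies wholly on one side of the line; reversing
  the line exchanges the sides, and \<open>bisect\<close> makes them equal.\<close>

lemma lefts_same:
  assumes "i \<in> I" "x < k" "y < k" "x \<noteq> y"
  shows "lefts J \<omega> (i, x) (i, y) = k * h + lefts {..<k} (orient_of D) x y"
    "rights J \<omega> (i, x) (i, y) = k * h + rights {..<k} (orient_of D) x y"
proof -
  have split: "(\<Sum>l\<in>I. F l) = (\<Sum>l\<in>I - {i}. F l) + F i" for F :: "'i \<Rightarrow> nat"
    using assms fin by (simp add: sum.remove[of I i])
  have own: "sgn (\<omega> (i, x) (i, y) (i, z)) = sgn (orient_of D x y z)" if "z < k" for z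
    using q_same[of i x y z] that assms by (simp add: orient_of_def)
  have ci: "card {z \<in> {..<k}. 0 < \<omega> (i, x) (i, y) (i, z)} = lefts {..<k} (orient_of D) x y"
    "card {z \<in> {..<k}. \<omega> (i, x) (i, y) (i, z) < 0} = rights {..<k} (orient_of D) x y"
    unfolding lefts_def rights_def using sgn_eq_pos_iff[OF own] sgn_eq_neg_iff[OF own] 
    by (auto intro!: arg_cong[where f = card])
  have cl: "card {z \<in> {..<k}. 0 < \<omega> (i, x) (i, y) (l, z)} = k * of_bool (if x < y then 0 < s i l else s i l < 0)"
    "card {z \<in> {..<k}. \<omega> (i, x) (i, y) (l, z) < 0} = k * of_bool (if x < y then s i l < 0 else 0 < s i l)"
    if "l \<in> I - {i}" for l
  proof -
    have "{z \<in> {..<k}. 0 < \<omega> (i, x) (i, y) (l, z)} = (if (if x < y then 0 < s i l else s i l < 0) then {..<k} else {})"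
      "{z \<in> {..<k}. \<omega> (i, x) (i, y) (l, z) < 0} = (if (if x < y then s i l < 0 else 0 < s i l) then {..<k} else {})"
      using q_pair_pos[of i l x y] assms that s_nonzero[of i l] by (auto simp: orient_of_def)
    then show "card {z \<in> {..<k}. 0 < \<omega> (i, x) (i, y) (l, z)} = k * of_bool (if x < y then 0 < s i l else s i l < 0)"
    "card {z \<in> {..<k}. \<omega> (i, x) (i, y) (l, z) < 0} = k * of_bool (if x < y then s i l < 0 else 0 < s i l)" 
      by simp_all
  qed
  have c0: "(\<Sum>l\<in>I - {i}. of_bool (Q l)) = card {l \<in> I - {i}. Q l}" for Q
    using fin by (simp add: sum_of_bool_eq Int_def)
  have hh: "(\<Sum>l\<in>I - {i}. of_bool (if x < y then 0 < s i l else s i l < 0)) = h"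
    "(\<Sum>l\<in>I - {i}. of_bool (if x < y then s i l < 0 else 0 < s i l)) = h"
    unfolding c0 by (cases "x < y"; simp only: if_True if_False bisect[OF assms(1)])+
  show "lefts J \<omega> (i, x) (i, y) = k * h + lefts {..<k} (orient_of D) x y"
    unfolding lefts_def[of J] card_slices[OF fin finite_lessThan] split ci
    by (simp only: cl sum_distrib_left[symmetric] hh cong: sum.cong)
  show "rights J \<omega> (i, x) (i, y) = k * h + rights {..<k} (orient_of D) x y"
    unfolding rights_def[of J] card_slices[OF fin finite_lessThan] split ci
    by (simp only: cl sum_distrib_left[symmetric] hh cong: sum.cong)
qed

lemma block_different:
  assumes "i \<in> I" "j \<in> I" "i \<noteq> j"
  shows "(\<Sum>x<k. \<Sum>y<k. real (lefts J \<omega> (i, x) (j, y) * rights J \<omega> (i, x) (j, y))) =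
    real k^4 * real (lefts I (orient_of P) i j * rights I (orient_of P) i j) +
    (real k^3 * (real k - 1) * (real (card I) - 2) + real k^2 * (real k - 1) * (5 * real k - 7) / 6)"
proof -
  define L R where "L = real (lefts I (orient_of P) i j)" "R = real (rights I (orient_of P) i j)"
  define F where "F x y = (k * L + x + y) * (k * R + (real k - 1 - x) + (real k - 1 - y))" for x y :: real
  have "(\<Sum>x<k. \<Sum>y<k. real (lefts J \<omega> (i, x) (j, y) * rights J \<omega> (i, x) (j, y))) = 
    (\<Sum>x<k. \<Sum>y<k. F (rk (0 < s i j) x) (rk (\<not> 0 < s j i) y))"
  proof (intro sum.cong refl)
    fix x y assume "x \<in> {..<k}" "y \<in> {..<k}"
    then have xy: "x < k" "y < k" by auto
    show "real (lefts J \<omega> (i, x) (j, y) * rights J \<omega> (i, x) (j, y)) = F (rk (0 < s i j) x) (rk (\<not> 0 < s j i) y)"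
      unfolding lefts_different[OF assms xy] F_def L_R_def
      using rk_not[OF xy(1), of "0 < s i j"] rk_not[OF xy(2), of "\<not> 0 < s j i"] by simp
  qed
  also have "\<dots> = (\<Sum>x<k. \<Sum>y<k. F x y)"
    by (simp only: sum_rk[of "F _"] sum_rk[of "\<lambda>x. \<Sum>y<k. F (real x) (real y)"])
  also have "\<dots> = real k^4 * (L * R) + real k^3 * (real k - 1) * (L + R) + real k^2 * (real k - 1) * (5 * real k - 7) / 6"
    unfolding F_def by (rule sum_uniform_ranks)
  \<comment> \<open>General position makes this sum the same for all pairs, so the base enters only
    through its size and its separations.\<close>
  also have "L + R = real (card I) - 2"
    unfolding L_R_def by (rule lefts_plus_rights[OF fin gp assms])
  finally show ?thesis by (simp add: L_R_def)
qed

lemma block_same: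
  assumes "i \<in> I"
  shows "(\<Sum>x<k. \<Sum>y<k. real (lefts J \<omega> (i, x) (i, y) * rights J \<omega> (i, x) (i, y))) =
    k * (real k - 1) * (real k^2 * real h^2 + k * h * (real k - 2)) + real (separations {..<k} (orient_of D))"
proof -
  \<comment> \<open>In the product of \<open>k * h + l\<close> and \<open>k * h + r\<close> the
    mixed term is \<open>k * h * (l + r)\<close>, and \<open>l + r = k - 2\<close> for every pair;
    only \<open>l * r\<close> remembers \<open>D\<close>.\<close>
  define c where "c = real k^2 * real h^2 + k * h * (real k - 2)"
  have "real (lefts J \<omega> (i, x) (i, y) * rights J \<omega> (i, x) (i, y)) = 
    (if x = y then 0 else c) + real (lefts {..<k} (orient_of D) x y * rights {..<k} (orient_of D) x y)"
    if xy: "x < k" "y < k" for x y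
  proof (cases "x = y")
    case True
    then show ?thesis by (simp add: lefts_def orient_of_def)
  next
    case False
    have *: "real (lefts {..<k} (orient_of D) x y) = real k - 2 - real (rights {..<k} (orient_of D) x y)"
      using lefts_plus_rights[OF finite_lessThan gp_D, of x y] xy False by simp
    show ?thesis unfolding lefts_same[OF assms xy False] using False
      by (simp add: c_def * algebra_simps power2_eq_square)
  qed
  then have "(\<Sum>x<k. \<Sum>y<k. real (lefts J \<omega> (i, x) (i, y) * rights J \<omega> (i, x) (i, y))) =
    (\<Sum>x<k. \<Sum>y<k. (if x = y then 0 else c)) + real (separations {..<k} (orient_of D))"
    by (simp add: separations_def sum.distrib)
  also have "(\<Sum>x<k. \<Sum>y<k. (if x = y then 0 else c)) = (\<Sum>x<k. (real k - 1) * c)"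
  proof (intro sum.cong refl)
    fix x assume "x \<in> {..<k}"
    then show "(\<Sum>y<k. (if x = y then 0 else c)) = (real k - 1) * c"
      by (simp add: sum.remove[of _ x] of_nat_diff)
  qed
  finally show ?thesis by (simp add: c_def)
qed

lemma separations_blow_up:
  "real (separations J \<omega>) = real k^4 * real (separations I (orient_of P)) 
    + card I * (real (card I) - 1) * 
      (real k^3 * (real k - 1) * (real (card I) - 2) + real k^2 * (real k - 1) * (5 * real k - 7) / 6)
    + card I * (k * (real k - 1) * (real k^2 * real h^2 + k * h * (real k - 2)) 
      + real (separations {..<k} (orient_of D)))"
proof -
  define c where "c = real k^3 * (real k - 1) * (real (card I) - 2) + real k^2 * (real k - 1) * (5 * real k - 7) / 6"
  define d where "d = k * (real k - 1) * (real k^2 * real h^2 + k * h * (real k - 2)) 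
    + real (separations {..<k} (orient_of D))"
  have "real (separations J \<omega>) = 
    (\<Sum>i\<in>I. \<Sum>x<k. \<Sum>j\<in>I. \<Sum>y<k. real (lefts J \<omega> (i, x) (j, y) * rights J \<omega> (i, x) (j, y)))"
    unfolding separations_def by (simp add: sum.cartesian_product')
  also have "\<dots> = (\<Sum>i\<in>I. \<Sum>j\<in>I. \<Sum>x<k. \<Sum>y<k. real (lefts J \<omega> (i, x) (j, y) * rights J \<omega> (i, x) (j, y)))"
    by (intro sum.cong refl sum.swap)
  also have "\<dots> = (\<Sum>i\<in>I. \<Sum>j\<in>I. real k^4 * real (lefts I (orient_of P) i j * rights I (orient_of P) i j) 
    + (if i = j then d else c))"
  proof (intro sum.cong refl)
    fix i j assume "i \<in> I" "j \<in> I"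
    \<comment> \<open>The base term is zero on the diagonal, so it may be added there and the full
      base sum splits off.\<close>
    moreover have "lefts I (orient_of P) i i = 0" by (simp add: lefts_def orient_of_def)
    ultimately show "(\<Sum>x<k. \<Sum>y<k. real (lefts J \<omega> (i, x) (j, y) * rights J \<omega> (i, x) (j, y))) =
      real k^4 * real (lefts I (orient_of P) i j * rights I (orient_of P) i j) + (if i = j then d else c)"
      using block_different[of i j] block_same[of i] by (cases "i = j") (auto simp: c_def d_def)
  qed
  also have "\<dots> = real k^4 * real (separations I (orient_of P)) + (\<Sum>i\<in>I. \<Sum>j\<in>I. if i = j then d else c)"
    by (simp add: separations_def sum.distrib sum_distrib_left)
  also have "(\<Sum>i\<in>I. \<Sum>j\<in>I. if i = j then d else c) = (\<Sum>i\<in>I. d + (real (card I) - 1) * c)"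
  proof (intro sum.cong refl)
    fix i assume i: "i \<in> I"
    then have "(\<Sum>j\<in>I. if i = j then d else c) = d + (\<Sum>j\<in>I - {i}. if i = j then d else c)"
      using fin by (simp add: sum.remove[of _ i]) 
    also have "(\<Sum>j\<in>I - {i}. if i = j then d else c) = (\<Sum>j\<in>I - {i}. c)"
      by (intro sum.cong) auto
    also have "\<dots> = (real (card I) - 1) * c"
      using fin i three by (simp add: of_nat_diff)
    finally show "(\<Sum>j\<in>I. if i = j then d else c) = d + (real (card I) - 1) * c" .
  qed
  finally show ?thesis by (simp add: c_def d_def algebra_simps)
qed

end

subsection \<open>The base configuration and the limit\<close>

text \<open>A set of fifteen points with 447 crossings, found by a computer search among the sets
  invariant under the linear map \<open>(x, y) \<mapsto> (- y, x - y)\<close> of order three; each point is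
  listed with a direction whose line through it bisects the other fourteen.\<close>

definition base_table :: "((int \<times> int) \<times> (int \<times> int)) list" where
  "base_table = [((-6, 1), (-4, 3)), ((-1, -7), (-3, 5)), ((7, 6), (-7, -4)), 
     ((5, 3), (-3, -4)), ((-3, 2), (-4, -1)), ((-2, -5), (-1, 3)), 
     ((-2, -9), (-4, -7)), ((9, 7), (-7, -3)), ((-7, 2), (-3, 4)), 
     ((-3, -12), (-1, -5)), ((12, 9), (-5, -4)), ((-9, 3), (-4, 1)), 
     ((-12, 4), (-8, 3)), ((-4, -16), (-3, -11)), ((16, 12), (-11, -8))]"

definition base_points :: "(int \<times> int) list" where
  "base_points = map fst base_table"

text \<open>All base points are keys of the table, so the default never enters for them.\<close>

definition base_direction :: "int \<times> int \<Rightarrow> int \<times> int" where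
  "base_direction p = (case map_of base_table p of Some u \<Rightarrow> u | None \<Rightarrow> (1, 0))"

definition int_orient :: "int \<times> int \<Rightarrow> int \<times> int \<Rightarrow> int \<times> int \<Rightarrow> int" where
  "int_orient a b c = (fst b - fst a) * (snd c - snd a) - (snd b - snd a) * (fst c - fst a)"

definition int_side :: "int \<times> int \<Rightarrow> int \<times> int \<Rightarrow> int" where
  "int_side p r = int_orient p (fst p + fst (base_direction p), snd p + snd (base_direction p)) r"

lemma base_checks:
  "distinct base_points" "length base_points = 15"
  "list_all (\<lambda>a. list_all (\<lambda>b. list_all (\<lambda>c. 
     a = b \<or> a = c \<or> b = c \<or> int_orient a b c \<noteq> 0) base_points) base_points) base_points"
  "list_all (\<lambda>p. length (filter (\<lambda>r. r \<noteq> p \<and> 0 < int_side p r) base_points) = 7 \<and> 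
     length (filter (\<lambda>r. r \<noteq> p \<and> int_side p r < 0) base_points) = 7) base_points"
  "list_all (\<lambda>p. base_direction p \<noteq> (0, 0) \<and>
     list_all (\<lambda>r. p = r \<or> int_side p r \<noteq> 0) base_points) base_points"
  by code_simp+

text \<open>7296 = 6 * (15 choose 4) - 2 * 447, which is how the 447 crossings enter.\<close>

lemma base_separations:
  "(\<Sum>a\<leftarrow>base_points. \<Sum>b\<leftarrow>base_points. length (filter (\<lambda>c. 0 < int_orient a b c) base_points) * 
     length (filter (\<lambda>c. int_orient a b c < 0) base_points)) = 7296"
  by code_simp

definition real_point :: "int \<times> int \<Rightarrow> real^2" where
  "real_point p = vector [of_int (fst p), of_int (snd p)]"

lemma orient_real_point: "orient (real_point a) (real_point b) (real_point c) = of_int (int_orient a b c)"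
  by (simp add: orient_def real_point_def int_orient_def)

lemma real_point_eq_iff: "real_point p = real_point q \<longleftrightarrow> p = q"
  by (auto simp: real_point_def vec_eq_iff forall_2 prod_eq_iff)

lemma real_point_plus_direction:
  "orient (real_point p) (real_point p + real_point (base_direction p)) (real_point r) = of_int (int_side p r)"
  by (simp add: orient_def real_point_def int_side_def int_orient_def)

lemma card_filter_distinct: "distinct xs \<Longrightarrow> card {c \<in> set xs. Q c} = length (filter Q xs)"
  using distinct_card[of "filter Q xs"] by simp

lemma separations_base: "separations (set base_points) (orient_of real_point) = 7296"
proof -
  have "separations (set base_points) (orient_of real_point) = 
    (\<Sum>a\<in>set base_points. \<Sum>b\<in>set base_points. length (filter (\<lambda>c. 0 < int_orient a b c) base_points) * 
     length (filter (\<lambda>c. int_orient a b c < 0) base_points))"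
    by (simp add: separations_def lefts_def rights_def orient_of_def orient_real_point
      card_filter_distinct[OF base_checks(1)])
  also have "\<dots> = 7296"
    by (simp only: sum.distinct_set_conv_list[OF base_checks(1)] base_separations)
  finally show ?thesis .
qed

text \<open>Here 210 = 15 * 14 counts ordered pairs of copies, 13 = 15 - 2 the further copies for
  each pair, and 49 and 7 come from \<open>h = 7\<close>. Inserting an optimal drawing makes the
  crossing number for \<open>k\<close> reappear on the right.\<close>

lemma crossing_number_15k:
  "2 * real (rectilinear_crossing_number (15 * k)) \<le> 6 * real (15 * k choose 4) 
    - 7296 * real k^4 - 210 * (13 * real k^3 * (real k - 1) + real k^2 * (real k - 1) * (5 * real k - 7) / 6)
    - 15 * (k * (real k - 1) * (49 * real k^2 + 7 * k * (real k - 2)) + 6 * real (k choose 4) 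
      - 2 * real (rectilinear_crossing_number k))"
proof -
  define I where "I = set base_points"
  have fin: "finite I" and card: "card I = 15"
    using distinct_card[OF base_checks(1)] base_checks(2) by (auto simp: I_def)
  have gp: "in_general_position I real_point"
  proof -
    have "inj_on real_point I" by (simp add: inj_on_def real_point_eq_iff)
    moreover have "\<forall>a\<in>I. \<forall>b\<in>I. \<forall>c\<in>I. a = b \<or> a = c \<or> b = c \<or> int_orient a b c \<noteq> 0"
      using base_checks(3) unfolding list_all_iff I_def .
    ultimately show ?thesis
      unfolding in_general_position_def orient_real_point of_int_eq_0_iff by blast
  qed
  obtain D where D: "\<And>i j. i < j \<Longrightarrow> j < k \<Longrightarrow> D i $ 1 < D j $ 1" "in_general_position {..<k} D"
    "real (separations {..<k} (orient_of D)) + 2 * real (rectilinear_crossing_number k) = 6 * real (k choose 4)"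
    using optimal_drawing_sorted[of k] by metis
  have injD: "inj_on (\<lambda>x. D x $ 1) {..<k}"
  proof (rule inj_onI)
    fix x y assume "x \<in> {..<k}" "y \<in> {..<k}" "D x $ 1 = D y $ 1"
    then show "x = y" using D(1)[of x y] D(1)[of y x] by (cases x y rule: linorder_cases) auto
  qed
  have dir: "real_point (base_direction i) \<noteq> 0" if "i \<in> I" for i
    using base_checks(5) that real_point_eq_iff[of "base_direction i" "(0, 0)"]
    by (auto simp: list_all_iff I_def real_point_def vec_eq_iff forall_2)
  have side: "orient (real_point i) (real_point i + real_point (base_direction i)) (real_point j) \<noteq> 0" 
    if "i \<in> I" "j \<in> I" "i \<noteq> j" for i j
    using base_checks(5) that by (auto simp: list_all_iff I_def real_point_plus_direction)
  obtain q where q: 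
    "\<And>i j l x y z. i \<in> I \<Longrightarrow> j \<in> I \<Longrightarrow> l \<in> I \<Longrightarrow> distinct [i, j, l] \<Longrightarrow> x < k \<Longrightarrow> y < k \<Longrightarrow> z < k \<Longrightarrow>
       sgn (orient (q (i, x)) (q (j, y)) (q (l, z))) = sgn (orient (real_point i) (real_point j) (real_point l))"
    "\<And>i j x y z. i \<in> I \<Longrightarrow> j \<in> I \<Longrightarrow> i \<noteq> j \<Longrightarrow> x < k \<Longrightarrow> y < k \<Longrightarrow> z < k \<Longrightarrow>
       sgn (orient (q (i, x)) (q (i, y)) (q (j, z))) = 
       sgn (D y $ 1 - D x $ 1) * sgn (orient (real_point i) (real_point i + real_point (base_direction i)) (real_point j))"
    "\<And>i x y z. i \<in> I \<Longrightarrow> x < k \<Longrightarrow> y < k \<Longrightarrow> z < k \<Longrightarrow>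
       sgn (orient (q (i, x)) (q (i, y)) (q (i, z))) = sgn (orient (D x) (D y) (D z))"
    using flattened_copies[OF fin gp injD dir side] by blast
  interpret blow_up I real_point "\<lambda>i j. of_int (int_side i j)" 7 k D q
  proof
    show "card {j \<in> I - {i}. 0 < (of_int (int_side i j) :: real)} = 7" 
      "card {j \<in> I - {i}. (of_int (int_side i j) :: real) < 0} = 7" if "i \<in> I" for i
    proof -
      have "{j \<in> I - {i}. Q j} = {j \<in> set base_points. j \<noteq> i \<and> Q j}" for Q by (auto simp: I_def)
      then show "card {j \<in> I - {i}. 0 < (of_int (int_side i j) :: real)} = 7" 
        "card {j \<in> I - {i}. (of_int (int_side i j) :: real) < 0} = 7"
        using base_checks(4) that card_filter_distinct[OF base_checks(1)] 
        by (simp_all add: list_all_iff I_def)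
    qed
  qed (use fin card gp D q side in \<open>simp_all add: real_point_plus_direction\<close>)
  have "real (separations J \<omega>) + 2 * real (rectilinear_crossing_number (card J)) \<le> 6 * real (card J choose 4)"
    by (rule separations_plus_crossing_number_le[OF _ gp_q]) (use fin in simp)
  moreover have "card J = 15 * k" by (simp add: card_cartesian_product card)
  moreover have "separations I (orient_of real_point) = 7296" unfolding I_def by (rule separations_base)
  moreover have "real (separations {..<k} (orient_of D)) = 6 * real (k choose 4) - 2 * real (rectilinear_crossing_number k)"
    using D(3) by simp
  ultimately show ?thesis
    using separations_blow_up by (simp add: card algebra_simps power2_eq_square power3_eq_cube)
qed

section \<open>Monotone ratio and passage to the limit\<close>

lemma crossing_ratio_incseq:
  "incseq (\<lambda>n. real (rectilinear_crossing_number n) / real (n choose 4))"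
proof (rule incseq_SucI)
  fix n
  show "real (rectilinear_crossing_number n) / real (n choose 4) \<le>
    real (rectilinear_crossing_number (Suc n)) / real (Suc n choose 4)"
  \<comment> \<open>For \<open>n < 4\<close> the left quotient has denominator zero and counts as 0;
    otherwise \<open>n - 3\<close> is positive and cancels.\<close>
  proof (cases "n < 4")
    case False
    then have pos: "real (n choose 4) > 0" "real (Suc n choose 4) > 0" "real n - 3 > 0" by auto
    have C: "real (Suc n choose 4) * (real n - 3) = real (Suc n) * real (n choose 4)"
      by (simp add: real_choose_4)
    have "real (rectilinear_crossing_number n) * (real (Suc n choose 4) * (real n - 3)) = 
      (real (Suc n) * real (rectilinear_crossing_number n)) * real (n choose 4)"
      by (subst C) (simp only: mult_ac)
    also have "\<dots> \<le> ((real n - 3) * real (rectilinear_crossing_number (Suc n))) * real (n choose 4)"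
      by (intro mult_right_mono crossing_number_Suc) simp
    finally have "(real n - 3) * (real (rectilinear_crossing_number n) * real (Suc n choose 4)) \<le>
      (real n - 3) * (real (rectilinear_crossing_number (Suc n)) * real (n choose 4))"
      by (simp only: mult_ac)
    then have "real (rectilinear_crossing_number n) * real (Suc n choose 4) \<le>
      real (rectilinear_crossing_number (Suc n)) * real (n choose 4)"
      using pos(3) by (simp only: mult_le_cancel_left_pos)
    then show ?thesis 
      using pos(1,2) by (simp only: pos_divide_le_eq times_divide_eq_left pos_le_divide_eq)
  qed (simp add: binomial_eq_0)
qed

text \<open>Dropping the nonnegative separations leaves a crude bound, enough for convergence and
  for having no crossings below four points.\<close>

lemma crossing_number_le_choose: "real (rectilinear_crossing_number n) \<le> 3 * real (n choose 4)"
proof -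
  obtain g :: "nat \<Rightarrow> real^2" where 
    "real (separations {..<n} (orient_of g)) + 2 * real (rectilinear_crossing_number n) = 6 * real (n choose 4)"
    using optimal_drawing_sorted[of n] by metis
  then show ?thesis
    using of_nat_0_le_iff[of "separations {..<n} (orient_of g)", where 'a = real] by linarith
qed

lemma crossing_ratio_le: "real (rectilinear_crossing_number n) / real (n choose 4) \<le> 3"
  using crossing_number_le_choose[of n] 
  by (cases "(n choose 4) = 0") (simp_all add: divide_le_eq)

theorem theorem1:
  "convergent (\<lambda>n. real (rectilinear_crossing_number n) / real (n choose 4)) \<and>
   lim (\<lambda>n. real (rectilinear_crossing_number n) / real (n choose 4)) \<le> 6467 / 16848"
proof -
  define r where "r n = real (rectilinear_crossing_number n) / real (n choose 4)" for n
  have "incseq r" "\<forall>n. r n \<le> 3" 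
    using crossing_ratio_incseq crossing_ratio_le by (simp_all add: r_def[abs_def])
  then obtain L where L: "r \<longlonglongrightarrow> L" by (rule incseq_convergent)
  \<comment> \<open>The inequality for \<open>15 * k\<close> is divided by \<open>k^4\<close>:
    \<open>A\<close> and \<open>C\<close> are the coefficients of the two ratios, \<open>B\<close>
    collects what involves no crossing number.\<close>
  define A where "A k = 2 * real (15 * k choose 4) / real k^4" for k
  define C where "C k = 30 * real (k choose 4) / real k^4" for k
  define B where "B k = (6 * real (15 * k choose 4) 
    - 7296 * real k^4 - 210 * (13 * real k^3 * (real k - 1) + real k^2 * (real k - 1) * (5 * real k - 7) / 6)
    - 15 * (k * (real k - 1) * (49 * real k^2 + 7 * k * (real k - 2)) + 6 * real (k choose 4))) / real k^4" for k
  have cr: "real (rectilinear_crossing_number n) = r n * real (n choose 4)" for n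
  proof (cases "(n choose 4) = 0")
    case True
    then show ?thesis using crossing_number_le_choose[of n] by (simp only: of_nat_0 mult_zero_right)
  qed (simp add: r_def)
  have le: "r (15 * k) * A k \<le> B k + r k * C k" if "k \<ge> 1" for k
  proof -
    have "r (15 * k) * A k - r k * C k = (2 * real (rectilinear_crossing_number (15 * k)) 
      - 30 * real (rectilinear_crossing_number k)) / real k^4"
      by (simp add: A_def C_def cr diff_divide_distrib mult_ac)
    also have "\<dots> \<le> B k"
      unfolding B_def using crossing_number_15k[of k] by (intro divide_right_mono) simp_all
    finally show ?thesis by simp
  qed
  have "filterlim (\<lambda>k::nat. 15 * k) at_top sequentially"
    by (rule filterlim_subseq) (simp add: strict_mono_def)
  then have L15: "(\<lambda>k. r (15 * k)) \<longlonglongrightarrow> L" by (rule filterlim_compose[OF L])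
  \<comment> \<open>The limits are 2 * 15^4 / 24, 30 / 24 and twice 447 + 15 * 21 + 15 * 14 / 8 + 15
    * 14 / 12.\<close>
  have A: "A \<longlonglongrightarrow> 50625 / 12" and C: "C \<longlonglongrightarrow> 5 / 4" and B: "B \<longlonglongrightarrow> 3223 / 2"
    unfolding A_def B_def C_def real_choose_4 of_nat_mult of_nat_numeral by real_asymp+
  have "L * (50625 / 12) \<le> 3223 / 2 + L * (5 / 4)"
  proof (rule LIMSEQ_le)
    show "(\<lambda>k. r (15 * k) * A k) \<longlonglongrightarrow> L * (50625 / 12)" by (intro tendsto_mult L15 A)
    show "(\<lambda>k. B k + r k * C k) \<longlonglongrightarrow> 3223 / 2 + L * (5 / 4)" by (intro tendsto_add tendsto_mult L B C)
    show "\<exists>N. \<forall>n\<ge>N. r (15 * n) * A n \<le> B n + r n * C n" using le by blast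
  qed
  \<comment> \<open>Solving gives \<open>L \<le> 3223 / 8435\<close>, which is smaller than the
    claimed bound.\<close>
  then have "L \<le> 6467 / 16848" by simp
  with L show ?thesis unfolding r_def[symmetric] by (auto simp: convergent_def limI)
qed

end
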